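(* There is a polynomial $p$ (independent of all data below) such that the following holds. Let $n \ge 1$, let $f \in \mathbb{Q}[x_1,\dots,x_n]$ be a convex polynomial, and let $P = \{x \in \mathbb{R}^n : Ax \le b\}$ be a nonempty convex polyhedron with $A \in \mathbb{Q}^{m\times n}$, $b \in \mathbb{Q}^m$. Then either $f$ is unbounded from below on $P$, or $f$ attains its minimum on $P$ at some point $x^* \in P$ with \[ \log \|x^*\| \le p(\langle f\rangle, \langle P\rangle). \]
   Context: The bit length $\mathrm{bl}(k)$ of an integer $k$ is $\max\{1,\lceil \log_2|k|\rceil\}$; the bit length of a reduced fraction $r=p/q$ is $\mathrm{bl}(p)+\mathrm{bl}(q)$; the bit length of a rational vector or matrix is the sum of the bit lengths of its entries; the bit length of $f=\sum_\alpha f_\alpha x^\alpha\in\mathbb{Q}[x]$ is the sum of the bit lengths of its nonzero coefficients. The encoding length of $f$ is $\langle f\rangle = n + \deg(f) + \sum_{\alpha: f_\alpha\neq 0}\mathrm{bl}(f_\alpha)$ (coefficients in binary, exponents in unary). The encoding length of $P=\{Ax\le b\}$ is $\langle P\rangle = \mathrm{bl}(A)+\mathrm{bl}(b)$, with the convention $\langle P\rangle \ge n$ when $P=\mathbb{R}^n$. $\|\cdot\|$ is the Euclidean norm. *)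

theory Defs
  imports Complex_Main
begin

definition Rn :: "nat \<Rightarrow> (nat \<Rightarrow> real) set" where
  "Rn n = {x. \<forall>i\<ge>n. x i = 0}"

definition enorm :: "nat \<Rightarrow> (nat \<Rightarrow> real) \<Rightarrow> real" where
  "enorm n x = sqrt (\<Sum>i<n. (x i)^2)"

(* A polynomial in Q[x_1..x_n] is given by its coefficient function on exponent
   vectors alpha :: nat => nat; it must have finite support and only use variables < n. *)
definition mpoly_support :: "((nat \<Rightarrow> nat) \<Rightarrow> rat) \<Rightarrow> (nat \<Rightarrow> nat) set" where
  "mpoly_support f = {\<alpha>. f \<alpha> \<noteq> 0}"

definition is_mpoly :: "nat \<Rightarrow> ((nat \<Rightarrow> nat) \<Rightarrow> rat) \<Rightarrow> bool" where
  "is_mpoly n f \<longleftrightarrow> finite (mpoly_support f) \<and>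
     (\<forall>\<alpha>\<in>mpoly_support f. \<forall>i\<ge>n. \<alpha> i = 0)"

definition mpoly_eval :: "nat \<Rightarrow> ((nat \<Rightarrow> nat) \<Rightarrow> rat) \<Rightarrow> (nat \<Rightarrow> real) \<Rightarrow> real" where
  "mpoly_eval n f x = (\<Sum>\<alpha>\<in>mpoly_support f. of_rat (f \<alpha>) * (\<Prod>i<n. (x i) ^ (\<alpha> i)))"

definition mpoly_degree :: "nat \<Rightarrow> ((nat \<Rightarrow> nat) \<Rightarrow> rat) \<Rightarrow> nat" where
  "mpoly_degree n f = Max (insert 0 ((\<lambda>\<alpha>. \<Sum>i<n. \<alpha> i) ` mpoly_support f))"

definition convex_mpoly :: "nat \<Rightarrow> ((nat \<Rightarrow> nat) \<Rightarrow> rat) \<Rightarrow> bool" where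
  "convex_mpoly n f \<longleftrightarrow> (\<forall>x\<in>Rn n. \<forall>y\<in>Rn n. \<forall>t::real. 0 \<le> t \<and> t \<le> 1 \<longrightarrow>
     mpoly_eval n f (\<lambda>i. t * x i + (1 - t) * y i)
       \<le> t * mpoly_eval n f x + (1 - t) * mpoly_eval n f y)"

definition bl_int :: "int \<Rightarrow> nat" where
  "bl_int k = nat (max 1 \<lceil>log 2 \<bar>real_of_int k\<bar>\<rceil>)"

definition bl_rat :: "rat \<Rightarrow> nat" where
  "bl_rat r = (case quotient_of r of (p, q) \<Rightarrow> bl_int p + bl_int q)"

definition enc_mpoly :: "nat \<Rightarrow> ((nat \<Rightarrow> nat) \<Rightarrow> rat) \<Rightarrow> nat" where
  "enc_mpoly n f = n + mpoly_degree n f + (\<Sum>\<alpha>\<in>mpoly_support f. bl_rat (f \<alpha>))"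

definition polyhedron :: "nat \<Rightarrow> nat \<Rightarrow> (nat \<Rightarrow> nat \<Rightarrow> rat) \<Rightarrow> (nat \<Rightarrow> rat) \<Rightarrow> (nat \<Rightarrow> real) set" where
  "polyhedron m n A b = {x \<in> Rn n. \<forall>i<m. (\<Sum>j<n. of_rat (A i j) * x j) \<le> of_rat (b i)}"

(* encoding length <P> = bl(A) + bl(b); with the convention <P> >= n (relevant
   only when m = 0, i.e. P = R^n, since otherwise bl(A) >= n already) *)
definition enc_polyhedron :: "nat \<Rightarrow> nat \<Rightarrow> (nat \<Rightarrow> nat \<Rightarrow> rat) \<Rightarrow> (nat \<Rightarrow> rat) \<Rightarrow> nat" where
  "enc_polyhedron m n A b =
     max n ((\<Sum>i<m. \<Sum>j<n. bl_rat (A i j)) + (\<Sum>i<m. bl_rat (b i)))"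

definition poly2 :: "(nat \<Rightarrow> nat \<Rightarrow> real) \<Rightarrow> nat \<Rightarrow> real \<Rightarrow> real \<Rightarrow> real" where
  "poly2 c D u v = (\<Sum>i\<le>D. \<Sum>j\<le>D. c i j * u ^ i * v ^ j)"

end

theory Submission
  imports
    Defs
    "HOL-Analysis.Derivative"
    "HOL-Analysis.Function_Topology"
    "HOL-Analysis.L2_Norm"
    "Jordan_Normal_Form.Determinant"
begin

text \<open>After scaling, \<open>F\<close> has integer coefficients and degree at most \<open>d\<close>. Let \<open>G\<close> be the sum of the
  Hessians of \<open>F\<close> over the grid \<open>{0..d}\<^sup>n\<close>: a positive semidefinite integer matrix whose entries have
  polynomially many bits. If \<open>G u = 0\<close>, then \<open>x \<mapsto> u\<^sup>T (\<nabla>\<^sup>2 F(x)) u\<close> vanishes on the grid, hence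
  everywhere, so \<open>F\<close> is affine in direction \<open>u\<close>. In general, for every \<open>u\<close> some grid point has
  curvature at least proportional to \<open>u\<^sup>T G u\<close> in direction \<open>u\<close>, and convexity transports this to
  \<open>F(x) \<ge> \<kappa> x\<^sup>T G x - K (1 + |x|)\<close>, with \<open>x\<^sup>T G x\<close> bounded below by a multiple of \<open>|G x|\<^sup>2\<close>.

  Moving inside \<open>P\<close> along directions of \<open>ker G\<close> in which \<open>F\<close> does not increase until no further
  constraint can become tight, any \<open>x \<in> P\<close> is replaced by a point \<open>z \<in> P\<close> with \<open>F z \<le> F x\<close> that
  solves a linear system formed by tight constraints and the values \<open>G z\<close>; by Cramer's rule
  \<open>|z| \<le> K' (1 + |G z|)\<close>. For such \<open>z\<close> the lower bound on \<open>F\<close> is quadratic in \<open>|z|\<close>, so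
  \<open>F z \<le> F x\<^sub>0\<close> for a basic point \<open>x\<^sub>0\<close> of \<open>P\<close> bounds \<open>|z|\<close>, and the minimum of \<open>F\<close> over \<open>P\<close> equals the
  one over a compact part of \<open>P\<close>.\<close>

section \<open>Small solutions of integer linear systems\<close>

text \<open>Matrices are functions of which only the leading \<open>k\<close> by \<open>k\<close>
  block counts, so a list of vectors can be lengthened without a change of type.\<close>

definition fdet :: "nat \<Rightarrow> (nat \<Rightarrow> nat \<Rightarrow> int) \<Rightarrow> int" where
  "fdet k M = Determinant.det (Matrix.mat k k (\<lambda>(i, j). M i j))"

text \<open>Singularity over an integral domain already yields a kernel vector over that domain, so
  linear dependencies stay integral.\<close>

lemma fdet_eq_0_iff:
  "fdet k M = 0 \<longleftrightarrow> (\<exists>v. (\<exists>i<k. v i \<noteq> 0) \<and> (\<forall>i<k. (\<Sum>j<k. M i j * v j) = 0))"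
proof -
  let ?A = "Matrix.mat k k (\<lambda>(i, j). M i j)"
  have A: "?A \<in> carrier_mat k k" by simp
  have "fdet k M = 0 \<longleftrightarrow> (\<exists>v. v \<in> carrier_vec k \<and> v \<noteq> 0\<^sub>v k \<and> ?A *\<^sub>v v = 0\<^sub>v k)"
    unfolding fdet_def by (rule det_0_iff_vec_prod_zero[OF A])
  also have "\<dots> \<longleftrightarrow> (\<exists>v. (\<exists>i<k. v i \<noteq> 0) \<and> (\<forall>i<k. (\<Sum>j<k. M i j * v j) = 0))"
  proof
    assume "\<exists>v. v \<in> carrier_vec k \<and> v \<noteq> 0\<^sub>v k \<and> ?A *\<^sub>v v = 0\<^sub>v k"
    then obtain v where v: "v \<in> carrier_vec k" "v \<noteq> 0\<^sub>v k" "?A *\<^sub>v v = 0\<^sub>v k" by blast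
    have "\<exists>i<k. vec_index v i \<noteq> 0"
      using v(1,2) by (metis carrier_vecD eq_vecI index_zero_vec)
    moreover have "(\<Sum>j<k. M i j * vec_index v j) = 0" if "i < k" for i
    proof -
      have "vec_index (?A *\<^sub>v v) i = 0" using v(3) that by simp
      then show ?thesis
        using that v(1) by (simp add: scalar_prod_def lessThan_atLeast0)
    qed
    ultimately show "\<exists>v. (\<exists>i<k. v i \<noteq> 0) \<and> (\<forall>i<k. (\<Sum>j<k. M i j * v j) = 0)"
      by blast
  next
    assume "\<exists>v. (\<exists>i<k. v i \<noteq> 0) \<and> (\<forall>i<k. (\<Sum>j<k. M i j * v j) = 0)"
    then obtain v where v: "\<exists>i<k. v i \<noteq> 0" "\<And>i. i < k \<Longrightarrow> (\<Sum>j<k. M i j * v j) = 0"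
      by blast
    let ?v = "Matrix.vec k v"
    have "?v \<noteq> 0\<^sub>v k" using v(1) by (metis index_vec index_zero_vec(1))
    moreover have "?A *\<^sub>v ?v = 0\<^sub>v k"
      by (rule eq_vecI) (use v(2) in \<open>auto simp: scalar_prod_def lessThan_atLeast0\<close>)
    ultimately show "\<exists>v. v \<in> carrier_vec k \<and> v \<noteq> 0\<^sub>v k \<and> ?A *\<^sub>v v = 0\<^sub>v k"
      by (intro exI[of _ ?v]) auto
  qed
  finally show ?thesis .
qed

text \<open>The Leibniz formula has \<open>fact k\<close> terms, each a product of \<open>k\<close>
  entries.\<close>

lemma abs_det_le:
  fixes A :: "int mat"
  assumes A: "A \<in> carrier_mat k k" and B: "\<And>i j. i < k \<Longrightarrow> j < k \<Longrightarrow> \<bar>A $$ (i, j)\<bar> \<le> B"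
  shows "\<bar>Determinant.det A\<bar> \<le> fact k * B ^ k"
proof -
  have "\<bar>Determinant.det A\<bar>
      \<le> (\<Sum>p | p permutes {0..<k}. \<bar>signof p * (\<Prod>i = 0..<k. A $$ (i, p i))\<bar>)"
    unfolding det_def'[OF A] by (rule sum_abs)
  also have "\<dots> \<le> (\<Sum>p | p permutes {0..<k}. B ^ k)"
  proof (rule sum_mono)
    fix p assume "p \<in> {p. p permutes {0..<k}}"
    then have p: "p permutes {0..<k}" by simp
    have "\<bar>signof p * (\<Prod>i = 0..<k. A $$ (i, p i))\<bar> = (\<Prod>i = 0..<k. \<bar>A $$ (i, p i)\<bar>)"
      by (simp add: abs_mult abs_prod sign_def)
    also have "\<dots> \<le> (\<Prod>i = 0..<k. B)"
    proof (rule prod_mono)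
      fix i assume i: "i \<in> {0..<k}"
      then have "p i \<in> {0..<k}" using p by (simp only: permutes_in_image)
      then show "0 \<le> \<bar>A $$ (i, p i)\<bar> \<and> \<bar>A $$ (i, p i)\<bar> \<le> B" using B i by simp
    qed
    finally show "\<bar>signof p * (\<Prod>i = 0..<k. A $$ (i, p i))\<bar> \<le> B ^ k" by simp
  qed
  also have "\<dots> = fact k * B ^ k"
    using card_permutations[of "{0..<k}" k] by simp
  finally show ?thesis .
qed

text \<open>Entries of the adjugate are, up to sign, minors of order \<open>k - 1\<close>, to which
  the Leibniz bound applies; \<open>1 \<le> B\<close> allows rounding it up to order
  \<open>k\<close>.\<close>

lemma bounded_adjugate:
  assumes B: "\<And>i j. i < k \<Longrightarrow> j < k \<Longrightarrow> \<bar>M i j\<bar> \<le> B" and B1: "1 \<le> B"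
  obtains N where
    "\<forall>i<k. \<forall>j<k. (\<Sum>l<k. M i l * N l j) = (if i = j then fdet k M else 0)"
    "\<forall>i<k. \<forall>j<k. \<bar>N i j\<bar> \<le> fact k * B ^ k"
proof -
  let ?A = "Matrix.mat k k (\<lambda>(i, j). M i j)"
  let ?N = "\<lambda>i j. adj_mat ?A $$ (i, j)"
  have A: "?A \<in> carrier_mat k k" by simp
  note adj = adj_mat[OF A]
  have 1: "(\<Sum>l<k. M i l * ?N l j) = (if i = j then fdet k M else 0)" if "i < k" "j < k" for i j
  proof -
    have "(?A * adj_mat ?A) $$ (i, j) = (\<Sum>l<k. M i l * ?N l j)"
      using that adj(1) by (simp add: scalar_prod_def lessThan_atLeast0 times_mat_def)
    from this[symmetric] show ?thesis unfolding adj(2) using that by (auto simp: fdet_def)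
  qed
  have 2: "\<bar>?N i j\<bar> \<le> fact k * B ^ k" if ij: "i < k" "j < k" for i j
  proof -
    have D: "mat_delete ?A j i \<in> carrier_mat (k - 1) (k - 1)"
      using mat_delete_carrier[OF A] by simp
    have "\<bar>?N i j\<bar> = \<bar>Determinant.det (mat_delete ?A j i)\<bar>"
      using ij by (simp add: adj_mat_def cofactor_def abs_mult power_abs)
    also have "\<dots> \<le> fact (k - 1) * B ^ (k - 1)"
    proof (rule abs_det_le[OF D])
      fix a b assume "a < k - 1" "b < k - 1"
      then show "\<bar>mat_delete ?A j i $$ (a, b)\<bar> \<le> B"
        using ij B by (auto simp: mat_delete_def)
    qed
    also have "\<dots> \<le> fact k * B ^ k"
      using B1 by (intro mult_mono fact_mono power_increasing) auto
    finally show ?thesis .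
  qed
  show ?thesis by (rule that[of ?N]) (use 1 2 in auto)
qed

text \<open>The Gram matrix of the first \<open>k\<close> vectors of \<open>r\<close>. Its
  determinant tests a non-square list for linear independence and is an integer.\<close>

definition gram :: "nat \<Rightarrow> (nat \<Rightarrow> nat \<Rightarrow> int) \<Rightarrow> nat \<Rightarrow> nat \<Rightarrow> int" where
  "gram n r i j = (\<Sum>l<n. r i l * r j l)"

text \<open>With \<open>R\<close> the matrix of rows \<open>r i\<close>, the number
  \<open>v^T R R^T v\<close> is the squared length of \<open>R^T v\<close>, so a kernel vector of
  the Gram matrix is a dependency among the rows.\<close>

lemma gram_kernel:
  assumes "\<And>i. i < k \<Longrightarrow> (\<Sum>j<k. gram n r i j * v j) = 0" and "l < n"
  shows "(\<Sum>i<k. v i * r i l) = 0"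
proof -
  have "(\<Sum>l<n. (\<Sum>i<k. v i * r i l)\<^sup>2) = (\<Sum>i<k. v i * (\<Sum>j<k. gram n r i j * v j))"
  proof -
    have "(\<Sum>l<n. (\<Sum>i<k. v i * r i l)\<^sup>2) = (\<Sum>l<n. \<Sum>i<k. \<Sum>j<k. v i * r i l * (v j * r j l))"
      by (simp add: power2_eq_square sum_product)
    also have "\<dots> = (\<Sum>i<k. \<Sum>l<n. \<Sum>j<k. v i * r i l * (v j * r j l))"
      by (rule sum.swap)
    also have "\<dots> = (\<Sum>i<k. \<Sum>j<k. \<Sum>l<n. v i * r i l * (v j * r j l))"
      by (intro sum.cong refl sum.swap)
    also have "\<dots> = (\<Sum>i<k. v i * (\<Sum>j<k. gram n r i j * v j))"
      by (simp add: gram_def sum_distrib_left sum_distrib_right mult_ac)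
    finally show ?thesis .
  qed
  also have "\<dots> = 0" using assms(1) by simp
  finally have "\<forall>l\<in>{..<n}. (\<Sum>i<k. v i * r i l)\<^sup>2 = 0"
    by (subst (asm) sum_nonneg_eq_0_iff) auto
  then show ?thesis using assms(2) by simp
qed

lemma fdet_gram_nonzero_imp_le:
  assumes "fdet k (gram n r) \<noteq> 0"
  shows "k \<le> n"
proof (rule ccontr)
  assume "\<not> k \<le> n"
  then have nk: "n < k" by simp
  \<comment> \<open>Zero columns make the array square, so that determinants multiply; column
    \<open>n\<close> vanishes, hence so does the determinant of \<open>R\<close>.\<close>
  define R where "R = Matrix.mat k k (\<lambda>(i, l). if l < n then r i l else 0)"
  have R: "R \<in> carrier_mat k k" by (simp add: R_def)
  have "Matrix.mat k k (\<lambda>(i, j). gram n r i j) = R * R\<^sup>T"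
  proof (rule eq_matI)
    fix i j assume "i < dim_row (R * R\<^sup>T)" "j < dim_col (R * R\<^sup>T)"
    then have ij: "i < k" "j < k" by (auto simp: R_def)
    have "(R * R\<^sup>T) $$ (i, j)
        = (\<Sum>l<k. (if l < n then r i l else 0) * (if l < n then r j l else 0))"
      using ij by (simp add: R_def scalar_prod_def lessThan_atLeast0)
    also have "\<dots> = (\<Sum>l<n. r i l * r j l)"
      by (rule sum.mono_neutral_cong_right) (use nk in auto)
    finally show "Matrix.mat k k (\<lambda>(i, j). gram n r i j) $$ (i, j) = (R * R\<^sup>T) $$ (i, j)"
      using ij by (simp add: gram_def)
  qed (auto simp: R_def)
  then have "fdet k (gram n r) = Determinant.det R * Determinant.det R\<^sup>T"
    unfolding fdet_def using det_mult[OF R, of "R\<^sup>T"] R by simp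
  moreover have "Determinant.det R = 0"
  proof -
    have "fdet k (\<lambda>i l. if l < n then r i l else 0) = 0"
      unfolding fdet_eq_0_iff
      by (rule exI[of _ "\<lambda>l. if l = n then 1 else 0"])
        (use nk in \<open>auto intro!: sum.neutral\<close>)
    then show ?thesis by (simp add: fdet_def R_def)
  qed
  ultimately show False using assms by simp
qed

text \<open>A list of maximal length with nonzero Gram determinant is a basis of the span of
  \<open>S\<close>. Lengths are at most \<open>n\<close>, so a maximum exists even for infinite
  \<open>S\<close>.\<close>

lemma maximal_gram_list:
  fixes S :: "(nat \<Rightarrow> int) set"
  obtains k r where "k \<le> n" "fdet k (gram n r) \<noteq> 0" "\<forall>i<k. r i \<in> S"
    "\<forall>a\<in>S. \<exists>v w. w \<noteq> 0 \<and> (\<forall>l<n. w * a l = (\<Sum>i<k. v i * r i l))"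
proof -
  define Q where
    "Q k \<longleftrightarrow> (\<exists>r. fdet k (gram n r) \<noteq> 0 \<and> (\<forall>i<k. r i \<in> S))" for k
  have Q0: "Q 0" by (simp add: Q_def fdet_eq_0_iff)
  have Qle: "k \<le> n" if "Q k" for k using that fdet_gram_nonzero_imp_le by (auto simp: Q_def)
  define k where "k = (GREATEST k. Q k)"
  have "Q k" unfolding k_def using GreatestI_nat[of Q, OF Q0] Qle by blast
  then obtain r where r: "fdet k (gram n r) \<noteq> 0" "\<And>i. i < k \<Longrightarrow> r i \<in> S"
    by (auto simp: Q_def)
  have max: "\<not> Q (Suc k)"
    using Greatest_le_nat[of Q "Suc k" n] Qle unfolding k_def[symmetric] by auto
  show ?thesis
  proof (rule that)
    show "k \<le> n" using Qle[OF \<open>Q k\<close>] .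
    show "fdet k (gram n r) \<noteq> 0" by (rule r(1))
    show "\<forall>i<k. r i \<in> S" using r(2) by blast
  next
    show "\<forall>a\<in>S. \<exists>v w. w \<noteq> 0 \<and> (\<forall>l<n. w * a l = (\<Sum>i<k. v i * r i l))"
    proof
      fix a assume a: "a \<in> S"
      let ?r = "r(k := a)"
      have "fdet (Suc k) (gram n ?r) = 0"
      proof (rule ccontr)
        assume "fdet (Suc k) (gram n ?r) \<noteq> 0"
        moreover have "\<forall>i<Suc k. ?r i \<in> S" using a r(2) by (simp add: less_Suc_eq)
        ultimately show False using max unfolding Q_def by blast
      qed
      then obtain v where v: "\<exists>i<Suc k. v i \<noteq> 0"
        "\<And>i. i < Suc k \<Longrightarrow> (\<Sum>j<Suc k. gram n ?r i j * v j) = 0"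
        unfolding fdet_eq_0_iff by blast
      have ker: "(\<Sum>i<k. v i * r i l) + v k * a l = 0" if "l < n" for l
        using gram_kernel[OF v(2) that] by simp
      \<comment> \<open>Otherwise the dependency would involve only the old vectors, whose Gram
        determinant is nonzero.\<close>
      have "v k \<noteq> 0"
      proof
        assume vk: "v k = 0"
        then have "\<exists>i<k. v i \<noteq> 0" using v(1) by (metis less_Suc_eq)
        moreover have "(\<Sum>j<k. gram n r i j * v j) = 0" if "i < k" for i
          using v(2)[of i] that vk by (simp add: gram_def)
        ultimately show False using r(1) unfolding fdet_eq_0_iff by blast
      qed
      then show "\<exists>v w. w \<noteq> 0 \<and> (\<forall>l<n. w * a l = (\<Sum>i<k. v i * r i l))"
        using ker by (intro exI[of _ v] exI[of _ "- v k"]) (simp add: algebra_simps add_eq_0_iff)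
    qed
  qed
qed

definition dot :: "nat \<Rightarrow> (nat \<Rightarrow> int) \<Rightarrow> (nat \<Rightarrow> real) \<Rightarrow> real" where
  "dot n a x = (\<Sum>j<n. real_of_int (a j) * x j)"

lemma dot_add_scale: "dot n a (\<lambda>i. x i + t * u i) = dot n a x + t * dot n a u"
  by (simp add: dot_def sum.distrib sum_distrib_left algebra_simps)

lemma dot_minus: "dot n a (\<lambda>i. - u i) = - dot n a u"
  by (simp add: dot_def sum_negf)

text \<open>One factor \<open>n\<close> for each of the two matrix-vector products in
  \<open>small_solution\<close>, \<open>E\<close> for the entries of the vectors, and the rest for
  the adjugate of a Gram matrix with entries at most \<open>n * E^2\<close>.\<close>

definition lin_bound :: "nat \<Rightarrow> real \<Rightarrow> real" where
  "lin_bound n E = (real n)\<^sup>2 * E * (fact n * (real n * E\<^sup>2) ^ n)"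

text \<open>The solution is \<open>B\<^sup>T (B B\<^sup>T)\<^sup>-\<^sup>1 q\<close> for a maximal independent list \<open>B\<close> of vectors of \<open>S\<close>;
  the Gram determinant is a nonzero integer, so dividing by it does no harm.\<close>

lemma small_solution:
  fixes S :: "(nat \<Rightarrow> int) set" and E :: int
  assumes E: "\<And>a j. a \<in> S \<Longrightarrow> j < n \<Longrightarrow> \<bar>a j\<bar> \<le> E" "1 \<le> E"
    and Q: "\<And>a. a \<in> S \<Longrightarrow> \<bar>dot n a x\<bar> \<le> Q" "0 \<le> Q"
  obtains z where "z \<in> Rn n" "\<And>a. a \<in> S \<Longrightarrow> dot n a z = dot n a x"
    "\<And>j. j < n \<Longrightarrow> \<bar>z j\<bar> \<le> lin_bound n (of_int E) * Q"
proof -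
  obtain k r where k: "k \<le> n" and det: "fdet k (gram n r) \<noteq> 0"
    and r': "\<forall>i<k. r i \<in> S"
    and span: "\<forall>a\<in>S. \<exists>v w. w \<noteq> 0 \<and> (\<forall>l<n. w * a l = (\<Sum>i<k. v i * r i l))"
    by (rule maximal_gram_list)
  have r: "r i \<in> S" if "i < k" for i using r' that by blast
  \<comment> \<open>The maximum with 1 keeps \<open>1 \<le> B\<close> when
    \<open>n = 0\<close>.\<close>
  define B where "B = max 1 (int n * E\<^sup>2)"
  have gB: "\<bar>gram n r i j\<bar> \<le> B" if "i < k" "j < k" for i j
  proof -
    have "\<bar>gram n r i j\<bar> \<le> (\<Sum>l<n. \<bar>r i l * r j l\<bar>)" unfolding gram_def by (rule sum_abs)
    also have "\<dots> \<le> (\<Sum>l<n. E\<^sup>2)"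
      using E r that by (intro sum_mono) (auto simp: abs_mult power2_eq_square intro!: mult_mono)
    also have "\<dots> \<le> B" by (simp add: B_def)
    finally show ?thesis .
  qed
  have B1: "1 \<le> B" by (simp add: B_def)
  obtain N where N: "\<forall>i<k. \<forall>j<k.
      (\<Sum>l<k. gram n r i l * N l j) = (if i = j then fdet k (gram n r) else 0)"
    and NB: "\<forall>i<k. \<forall>j<k. \<bar>N i j\<bar> \<le> fact k * B ^ k"
    by (rule bounded_adjugate[OF gB B1])
  define D where "D = real_of_int (fdet k (gram n r))"
  have D1: "1 \<le> \<bar>D\<bar>" using det by (simp add: D_def flip: of_int_abs)
  \<comment> \<open>By the adjugate identity \<open>w / D\<close> solves the system with the Gram
    matrix; \<open>z\<close> combines the \<open>r i\<close> with these coefficients.\<close>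
  define w where "w i = (\<Sum>j<k. real_of_int (N i j) * dot n (r j) x)" for i
  define z where "z l = (if l < n then (\<Sum>i<k. real_of_int (r i l) * w i) / D else 0)" for l
  have zr: "dot n (r i) z = dot n (r i) x" if i: "i < k" for i
  proof -
    have "D * dot n (r i) z = (\<Sum>l<n. real_of_int (r i l) * (D * z l))"
      by (simp add: dot_def sum_distrib_left mult_ac)
    also have "\<dots> = (\<Sum>l<n. \<Sum>i'<k. real_of_int (r i l) * (real_of_int (r i' l) * w i'))"
    proof (intro sum.cong refl)
      fix l assume "l \<in> {..<n}"
      then have "D * z l = (\<Sum>i'<k. real_of_int (r i' l) * w i')" using D1 by (auto simp: z_def)
      then show "real_of_int (r i l) * (D * z l)
          = (\<Sum>i'<k. real_of_int (r i l) * (real_of_int (r i' l) * w i'))"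
        by (simp add: sum_distrib_left)
    qed
    also have "\<dots> = (\<Sum>i'<k. \<Sum>l<n. real_of_int (r i l) * (real_of_int (r i' l) * w i'))"
      by (rule sum.swap)
    also have "\<dots> = (\<Sum>i'<k. real_of_int (gram n r i i') * w i')"
      by (simp add: gram_def sum_distrib_left sum_distrib_right mult_ac)
    also have "\<dots> = (\<Sum>i'<k. \<Sum>j<k. real_of_int (gram n r i i' * N i' j) * dot n (r j) x)"
      by (simp add: w_def sum_distrib_left mult_ac)
    also have "\<dots> = (\<Sum>j<k. \<Sum>i'<k. real_of_int (gram n r i i' * N i' j) * dot n (r j) x)"
      by (rule sum.swap)
    also have "\<dots> = (\<Sum>j<k. real_of_int (\<Sum>i'<k. gram n r i i' * N i' j) * dot n (r j) x)"
      by (simp add: sum_distrib_right)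
    also have "\<dots> = (\<Sum>j<k. if i = j then D * dot n (r j) x else 0)"
      by (intro sum.cong refl) (use i in \<open>simp add: N D_def del: of_int_sum\<close>)
    also have "\<dots> = D * dot n (r i) x" using i by simp
    finally show ?thesis using D1 by auto
  qed
  show ?thesis
  proof (rule that)
    show "z \<in> Rn n" by (simp add: Rn_def z_def)
    show "dot n a z = dot n a x" if a: "a \<in> S" for a
    proof -
      obtain v c where c: "c \<noteq> 0" and v: "\<forall>l<n. c * a l = (\<Sum>i<k. v i * r i l)"
        using bspec[OF span a] by (elim exE conjE)
      \<comment> \<open>The integral relation between \<open>a\<close> and the list carries over to
        values at every point, so agreement on the list forces agreement on
        \<open>a\<close>.\<close>
      have *: "of_int c * dot n a y = (\<Sum>i<k. of_int (v i) * dot n (r i) y)" for y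
      proof -
        have "of_int c * dot n a y = (\<Sum>l<n. of_int (c * a l) * y l)"
          by (simp add: dot_def sum_distrib_left mult_ac)
        also have "\<dots> = (\<Sum>l<n. \<Sum>i<k. of_int (v i) * (of_int (r i l) * y l))"
          by (intro sum.cong refl) (simp add: v sum_distrib_left sum_distrib_right mult_ac)
        also have "\<dots> = (\<Sum>i<k. \<Sum>l<n. of_int (v i) * (of_int (r i l) * y l))"
          by (rule sum.swap)
        finally show ?thesis by (simp add: dot_def sum_distrib_left)
      qed
      have "of_int c * dot n a z = of_int c * dot n a x"
        unfolding * by (simp add: zr)
      then show ?thesis using c by simp
    qed
    show "\<bar>z l\<bar> \<le> lin_bound n (of_int E) * Q" if l: "l < n" for l
    proof -
      have B: "B = int n * E\<^sup>2"
      proof -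
        have "1 \<le> int n" using l by simp
        moreover have "1 \<le> E\<^sup>2" using E(2) by simp
        ultimately have "1 * 1 \<le> int n * E\<^sup>2" by (intro mult_mono) auto
        then show ?thesis by (simp add: B_def)
      qed
      define C :: real where "C = fact n * (real n * (of_int E)\<^sup>2) ^ n"
      have C0: "0 \<le> C" by (simp add: C_def)
      have NC: "\<bar>real_of_int (N i j)\<bar> \<le> C" if "i < k" "j < k" for i j
      proof -
        have "\<bar>N i j\<bar> \<le> fact k * B ^ k" using NB that by blast
        also have "\<dots> \<le> fact n * B ^ n"
          using B1 k by (intro mult_mono fact_mono power_increasing) auto
        finally have "real_of_int \<bar>N i j\<bar> \<le> real_of_int (fact n * B ^ n)"
          by (simp only: of_int_le_iff)
        then show ?thesis by (simp add: C_def B)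
      qed
      have w: "\<bar>w i\<bar> \<le> real n * (C * Q)" if "i < k" for i
      proof -
        have "\<bar>w i\<bar> \<le> (\<Sum>j<k. \<bar>real_of_int (N i j) * dot n (r j) x\<bar>)"
          unfolding w_def by (rule sum_abs)
        also have "\<dots> \<le> (\<Sum>j<k. C * Q)"
          using NC that Q r C0 by (intro sum_mono) (auto simp: abs_mult intro!: mult_mono)
        also have "\<dots> \<le> real n * (C * Q)" using k C0 Q(2) by (simp add: mult_right_mono)
        finally show ?thesis .
      qed
      have "\<bar>z l\<bar> = \<bar>\<Sum>i<k. real_of_int (r i l) * w i\<bar> / \<bar>D\<bar>" using l by (simp add: z_def)
      also have "\<dots> \<le> \<bar>\<Sum>i<k. real_of_int (r i l) * w i\<bar>"
        using divide_left_mono[of 1 "\<bar>D\<bar>" "\<bar>\<Sum>i<k. real_of_int (r i l) * w i\<bar>"] D1 by simp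
      also have "\<dots> \<le> (\<Sum>i<k. \<bar>real_of_int (r i l) * w i\<bar>)" by (rule sum_abs)
      also have "\<dots> \<le> (\<Sum>i<k. of_int E * (real n * (C * Q)))"
      proof (rule sum_mono)
        fix i assume i: "i \<in> {..<k}"
        have "real_of_int \<bar>r i l\<bar> \<le> of_int E" using E(1)[OF r] i l by (simp only: of_int_le_iff) simp
        then show "\<bar>real_of_int (r i l) * w i\<bar> \<le> of_int E * (real n * (C * Q))"
          using w i E(2) unfolding abs_mult by (intro mult_mono) auto
      qed
      also have "\<dots> \<le> real n * (of_int E * (real n * (C * Q)))"
        using k C0 Q(2) E(2) by (simp add: mult_right_mono)
      finally show ?thesis by (simp add: lin_bound_def C_def power2_eq_square mult_ac)
    qed
  qed
qed

section \<open>Basic points of polyhedra\<close>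

text \<open>The rows are integral because determinants built from them are divided by; of the
  right-hand sides only absolute values enter the bounds, so they may be real.\<close>

definition int_polyhedron :: "nat \<Rightarrow> nat \<Rightarrow> (nat \<Rightarrow> nat \<Rightarrow> int) \<Rightarrow> (nat \<Rightarrow> real) \<Rightarrow> (nat \<Rightarrow> real) set"
  where "int_polyhedron m n A b = {x \<in> Rn n. \<forall>i<m. dot n (A i) x \<le> b i}"

lemma Rn_add_scale: "x \<in> Rn n \<Longrightarrow> u \<in> Rn n \<Longrightarrow> (\<lambda>i. x i + t * u i) \<in> Rn n"
  by (simp add: Rn_def)

text \<open>The ratio test of the simplex method: walk along \<open>u\<close> until a constraint
  blocks. Constraints tight at \<open>z\<close> are constant along \<open>u\<close> and stay tight;
  the blocking one is new.\<close>

lemma int_polyhedron_step: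
  assumes z: "z \<in> int_polyhedron m n A b" and u: "u \<in> Rn n"
    and tight: "\<And>i. i < m \<Longrightarrow> dot n (A i) z = b i \<Longrightarrow> dot n (A i) u = 0"
    and pos: "\<exists>i<m. 0 < dot n (A i) u"
  obtains t where "0 \<le> t" "(\<lambda>i. z i + t * u i) \<in> int_polyhedron m n A b"
    "card {i. i < m \<and> dot n (A i) z = b i}
      < card {i. i < m \<and> dot n (A i) (\<lambda>i. z i + t * u i) = b i}"
proof -
  define J where "J = {i. i < m \<and> 0 < dot n (A i) u}"
  \<comment> \<open>The step length at which constraint \<open>i\<close> becomes tight.\<close>
  define r where "r i = (b i - dot n (A i) z) / dot n (A i) u" for i
  have J: "finite J" "J \<noteq> {}" using pos by (auto simp: J_def)
  define t where "t = Min (r ` J)"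
  have "t \<in> r ` J" unfolding t_def by (rule Min_in) (use J in auto)
  then obtain i0 where i0: "i0 \<in> J" "t = r i0" by blast
  have zP: "z \<in> Rn n" "\<And>i. i < m \<Longrightarrow> dot n (A i) z \<le> b i"
    using z by (auto simp: int_polyhedron_def)
  have t0: "0 \<le> t" using i0 zP(2) by (auto simp: r_def J_def)
  have tle: "t \<le> r i" if "i \<in> J" for i using that J by (simp add: t_def)
  have feas: "dot n (A i) z + t * dot n (A i) u \<le> b i" if "i < m" for i
  proof (cases "0 < dot n (A i) u")
    case True
    then have "t \<le> r i" using tle that by (simp add: J_def)
    then show ?thesis using True by (simp add: r_def field_simps)
  next
    case False
    then have "t * dot n (A i) u \<le> 0" using t0 by (simp add: mult_nonneg_nonpos)
    then show ?thesis using zP(2)[OF that] by simp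
  qed
  have "{i. i < m \<and> dot n (A i) z = b i}
      \<subset> {i. i < m \<and> dot n (A i) (\<lambda>i. z i + t * u i) = b i}"
  proof
    show "{i. i < m \<and> dot n (A i) z = b i}
        \<subseteq> {i. i < m \<and> dot n (A i) (\<lambda>i. z i + t * u i) = b i}"
      using tight by (auto simp: dot_add_scale)
    have "t * dot n (A i0) u = b i0 - dot n (A i0) z" using i0 by (simp add: J_def r_def)
    then have "i0 \<in> {i. i < m \<and> dot n (A i) (\<lambda>i. z i + t * u i) = b i}"
      using i0(1) by (simp add: dot_add_scale J_def)
    moreover have "i0 \<notin> {i. i < m \<and> dot n (A i) z = b i}"
      using i0 tight[of i0] by (auto simp: J_def)
    ultimately show "{i. i < m \<and> dot n (A i) z = b i}
        \<noteq> {i. i < m \<and> dot n (A i) (\<lambda>i. z i + t * u i) = b i}" by blast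
  qed
  then have "card {i. i < m \<and> dot n (A i) z = b i}
      < card {i. i < m \<and> dot n (A i) (\<lambda>i. z i + t * u i) = b i}"
    by (intro psubset_card_mono) auto
  with t0 feas zP(1) u show ?thesis
    by (intro that[of t]) (auto simp: int_polyhedron_def dot_add_scale Rn_add_scale)
qed

text \<open>Applied with \<open>S\<close> empty and \<open>F = 0\<close> to find a small feasible
  point, and with the rows of \<open>G\<close> to shrink points of a sublevel set. The scale
  \<open>Q\<close> cannot be bounded in advance: it may be a value \<open>dot n a z\<close> at the
  very point produced, to be controlled later by the growth of \<open>F\<close>.\<close>

lemma basic_point:
  fixes S :: "(nat \<Rightarrow> int) set" and E :: int and F :: "(nat \<Rightarrow> real) \<Rightarrow> real"
  assumes x: "x \<in> int_polyhedron m n A b"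
    and affine: "\<And>y u. y \<in> Rn n \<Longrightarrow> u \<in> Rn n \<Longrightarrow> (\<And>a. a \<in> S \<Longrightarrow> dot n a u = 0) \<Longrightarrow>
      \<exists>s. \<forall>t. F (\<lambda>i. y i + t * u i) = F y + s * t"
    and lower: "\<And>y. y \<in> int_polyhedron m n A b \<Longrightarrow> M \<le> F y"
    and S: "finite S" "\<And>a j. a \<in> S \<Longrightarrow> j < n \<Longrightarrow> \<bar>a j\<bar> \<le> E" "1 \<le> E"
    and A: "\<And>i j. i < m \<Longrightarrow> j < n \<Longrightarrow> \<bar>A i j\<bar> \<le> E"
    and b: "\<And>i. i < m \<Longrightarrow> \<bar>b i\<bar> \<le> H" "0 \<le> H"
  obtains z Q where "z \<in> int_polyhedron m n A b" "F z \<le> F x"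
    "\<forall>j<n. \<bar>z j\<bar> \<le> lin_bound n (of_int E) * Q" "Q = H \<or> (\<exists>a\<in>S. Q = \<bar>dot n a z\<bar>)"
proof -
  \<comment> \<open>A point of the sublevel set with as many tight constraints as possible is basic up to
    directions that leave all constraints and \<open>F\<close> unchanged.\<close>
  let ?P = "int_polyhedron m n A b"
  let ?T = "\<lambda>z. {i. i < m \<and> dot n (A i) z = b i}"
  have "card (?T y) \<le> card {..<m}" for y by (rule card_mono) auto
  then have "\<forall>y. y \<in> ?P \<and> F y \<le> F x \<longrightarrow> card (?T y) < Suc m" by (simp add: less_Suc_eq_le)
  then obtain z where z: "z \<in> ?P" "F z \<le> F x"
    and zmax: "\<And>y. y \<in> ?P \<Longrightarrow> F y \<le> F x \<Longrightarrow> card (?T y) \<le> card (?T z)"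
    using ex_has_greatest_nat[of "\<lambda>y. y \<in> ?P \<and> F y \<le> F x" x "\<lambda>y. card (?T y)" "Suc m"] x
    by auto
  have zR: "z \<in> Rn n" and zb: "\<And>i. i < m \<Longrightarrow> dot n (A i) z \<le> b i"
    using z(1) by (auto simp: int_polyhedron_def)
  \<comment> \<open>As \<open>F\<close> does not increase along \<open>u\<close>, walking until a
    constraint blocks would stay in the sublevel set and gain a tight constraint.\<close>
  have nonpos: "\<forall>i<m. dot n (A i) u \<le> 0"
    if u: "u \<in> Rn n" "\<And>i. i < m \<Longrightarrow> dot n (A i) z = b i \<Longrightarrow> dot n (A i) u = 0"
      and s: "\<And>t. F (\<lambda>i. z i + t * u i) = F z + s * t" "s \<le> 0" for u s
  proof (rule ccontr)
    assume "\<not> (\<forall>i<m. dot n (A i) u \<le> 0)"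
    then have pos: "\<exists>i<m. 0 < dot n (A i) u" by (simp add: not_le)
    obtain t where t: "0 \<le> t" "(\<lambda>i. z i + t * u i) \<in> ?P"
      "card (?T z) < card (?T (\<lambda>i. z i + t * u i))"
      by (rule int_polyhedron_step[OF z(1) u pos])
    have "s * t \<le> 0" using s(2) t(1) by (simp add: mult_nonpos_nonneg)
    then have "F (\<lambda>i. z i + t * u i) \<le> F x" using s(1)[of t] z(2) by simp
    then show False using zmax[OF t(2)] t(3) by simp
  qed
  have slope: "s = 0"
    if u: "u \<in> Rn n" "\<And>i. i < m \<Longrightarrow> dot n (A i) u \<le> 0"
      and s: "\<And>t. F (\<lambda>i. z i + t * u i) = F z + s * t" "s \<le> 0" for u s
  proof (rule ccontr)
    assume "s \<noteq> 0"
    then have neg: "s < 0" using s(2) by simp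
    \<comment> \<open>At this parameter \<open>F\<close> takes the value
      \<open>M - 1\<close>.\<close>
    define t where "t = (M - 1 - F z) / s"
    have "M - 1 - F z \<le> 0" using lower[OF z(1)] by simp
    then have t0: "0 \<le> t" using neg by (simp add: t_def divide_nonpos_neg)
    have "(\<lambda>i. z i + t * u i) \<in> ?P"
    proof -
      have "dot n (A i) z + t * dot n (A i) u \<le> b i" if "i < m" for i
        using zb[OF that] mult_nonneg_nonpos[OF t0 u(2)[OF that]] by simp
      then show ?thesis using zR u(1) by (auto simp: int_polyhedron_def dot_add_scale Rn_add_scale)
    qed
    then have "M \<le> F (\<lambda>i. z i + t * u i)" by (rule lower)
    then show False using s(1)[of t] neg by (simp add: t_def)
  qed
  have key: "(\<forall>i<m. dot n (A i) u = 0) \<and> (\<forall>t. F (\<lambda>i. z i + t * u i) = F z)"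
    if u: "u \<in> Rn n" "\<And>i. i < m \<Longrightarrow> dot n (A i) z = b i \<Longrightarrow> dot n (A i) u = 0"
      and uS: "\<And>a. a \<in> S \<Longrightarrow> dot n a u = 0" for u
  proof -
    \<comment> \<open>Once the slope is zero, \<open>- u\<close> meets the same hypotheses, so
      neither sign of \<open>dot n (A i) u\<close> is possible.\<close>
    have *: "(\<forall>i<m. dot n (A i) u = 0) \<and> (\<forall>t. F (\<lambda>i. z i + t * u i) = F z)"
      if u: "u \<in> Rn n" "\<And>i. i < m \<Longrightarrow> dot n (A i) z = b i \<Longrightarrow> dot n (A i) u = 0"
      and s: "\<And>t. F (\<lambda>i. z i + t * u i) = F z + s * t" "s \<le> 0" for u s
    proof -
      have le: "\<forall>i<m. dot n (A i) u \<le> 0" by (rule nonpos[OF u s])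
      then have s0: "s = 0" using slope[OF u(1) _ s] by blast
      have F0: "F (\<lambda>i. z i + t * u i) = F z" for t using s(1) s0 by simp
      have "\<forall>i<m. dot n (A i) (\<lambda>i. - u i) \<le> 0"
      proof (rule nonpos)
        show "(\<lambda>i. - u i) \<in> Rn n" using u(1) by (simp add: Rn_def)
        show "dot n (A i) (\<lambda>i. - u i) = 0" if "i < m" "dot n (A i) z = b i" for i
          using u(2)[OF that] by (simp add: dot_minus)
        show "F (\<lambda>i. z i + t * - u i) = F z + 0 * t" for t using F0[of "- t"] by simp
      qed simp
      then show ?thesis using le F0 by (auto simp: dot_minus intro: antisym)
    qed
    \<comment> \<open>At least one of \<open>u\<close> and \<open>- u\<close> has nonpositive
      slope.\<close>
    obtain s where s: "\<And>t. F (\<lambda>i. z i + t * u i) = F z + s * t"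
      using affine[OF zR u(1) uS] by blast
    show ?thesis
    proof (cases "s \<le> 0")
      case True
      then show ?thesis using *[OF u s] by simp
    next
      case False
      have neg: "(\<forall>i<m. dot n (A i) (\<lambda>i. - u i) = 0) \<and> (\<forall>t. F (\<lambda>i. z i + t * - u i) = F z)"
      proof (rule *)
        show "(\<lambda>i. - u i) \<in> Rn n" using u(1) by (simp add: Rn_def)
        show "dot n (A i) (\<lambda>i. - u i) = 0" if "i < m" "dot n (A i) z = b i" for i
          using u(2)[OF that] by (simp add: dot_minus)
        show "F (\<lambda>i. z i + t * - u i) = F z + (- s) * t" for t using s[of "- t"] by simp
        show "- s \<le> 0" using False by simp
      qed
      have "F (\<lambda>i. z i + t * u i) = F z" for t
        using conjunct2[OF neg, rule_format, of "- t"] by simp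
      then show ?thesis using neg by (simp add: dot_minus)
    qed
  qed
  \<comment> \<open>Including \<open>H\<close> makes \<open>Q\<close> bound the values of the tight
    constraints, which are entries of \<open>b\<close>, as well as those of
    \<open>S\<close>.\<close>
  define Q where "Q = Max (insert H ((\<lambda>a. \<bar>dot n a z\<bar>) ` S))"
  have QS: "\<bar>dot n a z\<bar> \<le> Q" if "a \<in> S" for a using S(1) that by (simp add: Q_def)
  have QH: "H \<le> Q" using S(1) by (simp add: Q_def)
  have Qc: "Q = H \<or> (\<exists>a\<in>S. Q = \<bar>dot n a z\<bar>)"
    using Max_in[of "insert H ((\<lambda>a. \<bar>dot n a z\<bar>) ` S)"] S(1) by (auto simp: Q_def)
  obtain y where y: "y \<in> Rn n" "\<forall>a\<in>A ` ?T z \<union> S. dot n a y = dot n a z"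
    "\<forall>j<n. \<bar>y j\<bar> \<le> lin_bound n (of_int E) * Q"
  proof (rule small_solution[of "A ` ?T z \<union> S" n E z Q])
    show "\<bar>a j\<bar> \<le> E" if "a \<in> A ` ?T z \<union> S" "j < n" for a j using that A S(2) by auto
    show "1 \<le> E" by (rule S(3))
    show "\<bar>dot n a z\<bar> \<le> Q" if "a \<in> A ` ?T z \<union> S" for a
      using that QS order_trans[OF b(1) QH] by auto
    show "0 \<le> Q" using b(2) QH by simp
  qed (use that in blast)
  \<comment> \<open>This difference annihilates the tight rows and \<open>S\<close>, so by
    \<open>key\<close> passing from \<open>z\<close> to \<open>y\<close> changes neither a
    constraint value nor \<open>F\<close>.\<close>
  define u where "u i = y i - z i" for i
  have uR: "u \<in> Rn n" using y(1) zR by (simp add: Rn_def u_def)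
  have yu: "y = (\<lambda>i. z i + 1 * u i)" by (simp add: u_def)
  have du: "dot n a y = dot n a z + dot n a u" for a
    unfolding yu by (subst dot_add_scale) simp
  have k: "(\<forall>i<m. dot n (A i) u = 0) \<and> (\<forall>t. F (\<lambda>i. z i + t * u i) = F z)"
    by (rule key[OF uR]) (use y(2) du in auto)
  have "y \<in> ?P" using y(1) zb k by (auto simp: int_polyhedron_def du)
  moreover have "F y \<le> F x"
    using conjunct2[OF k, rule_format, of 1] z(2) by (simp only: yu[symmetric])
  moreover have "Q = H \<or> (\<exists>a\<in>S. Q = \<bar>dot n a y\<bar>)" using Qc y(2) by auto
  ultimately show ?thesis using y(3) that by blast
qed

section \<open>Univariate convex polynomials\<close>

text \<open>Induction as in Newton interpolation: subtract the value at one node \<open>s\<close>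
  and divide by \<open>x - s\<close>. Nodes are distinct integers, hence at distance at least 1, so
  the quotient is at most \<open>2 * M\<close> at the other nodes.\<close>

lemma coeff_bound_of_values:
  fixes p :: "real poly" and S :: "nat set"
  assumes "finite S" "\<And>s. s \<in> S \<Longrightarrow> s \<le> N" "p = 0 \<or> degree p < card S"
    "\<And>s. s \<in> S \<Longrightarrow> \<bar>poly p (real s)\<bar> \<le> M" "0 \<le> M"
  shows "\<bar>coeff p i\<bar> \<le> M * (2 * real N + 3) ^ card S"
  using assms
proof (induction S arbitrary: p M i rule: finite_induct)
  case empty
  then show ?case by simp
next
  case (insert s S)
  define q where "q = synthetic_div p (real s)"
  have p: "p = [:poly p (real s):] + [:- real s, 1:] * q"
    using synthetic_div_correct'[of "real s" p] by (simp add: q_def add.commute)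
  have deg: "q = 0 \<or> degree q < card S"
  proof (cases "degree p = 0")
    case True
    then show ?thesis unfolding q_def by (simp add: synthetic_div_eq_0_iff)
  next
    case False
    then show ?thesis using insert.prems(2) insert.hyps by (auto simp: q_def degree_synthetic_div)
  qed
  have val: "\<bar>poly q (real t)\<bar> \<le> 2 * M" if t: "t \<in> S" for t
  proof -
    have "1 \<le> \<bar>real t - real s\<bar>" using t insert.hyps by (cases "t = s") auto
    then have "\<bar>poly q (real t)\<bar> \<le> \<bar>real t - real s\<bar> * \<bar>poly q (real t)\<bar>"
      by (simp add: mult_le_cancel_right1)
    also have "\<dots> = \<bar>poly p (real t) - poly p (real s)\<bar>"
    proof -
      have "poly p (real t) = poly p (real s) + (real t - real s) * poly q (real t)"
        by (subst p) (simp add: algebra_simps)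
      then show ?thesis by (simp add: abs_mult)
    qed
    also have "\<dots> \<le> 2 * M"
      using insert.prems(3)[of t] insert.prems(3)[of s] t by simp
    finally show ?thesis .
  qed
  have IH: "\<bar>coeff q j\<bar> \<le> 2 * M * (2 * real N + 3) ^ card S" for j
    using insert.prems(1,4) by (intro insert.IH deg val) auto
  define X where "X = 2 * M * (2 * real N + 3) ^ card S"
  have "\<bar>coeff p i\<bar> \<le> M + (real N + 1) * X"
  proof -
    have ms: "\<bar>poly p (real s)\<bar> \<le> M" and sN: "real s \<le> real N" using insert.prems by auto
    have X0: "0 \<le> X" using insert.prems(4) by (simp add: X_def)
    have 1: "real s * \<bar>coeff q i\<bar> \<le> real N * X"
      using IH[of i] sN by (intro mult_mono) (auto simp: X_def)
    have "coeff p i = (case i of 0 \<Rightarrow> poly p (real s) | Suc j \<Rightarrow> coeff q j) - real s * coeff q i"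
      by (subst p) (simp add: coeff_pCons split: nat.split)
    moreover have "\<bar>case i of 0 \<Rightarrow> poly p (real s) | Suc j \<Rightarrow> coeff q j\<bar> \<le> M + X"
      using ms IH insert.prems(4) X0 by (auto simp: X_def split: nat.split intro: order_trans add_increasing)
    moreover have "\<bar>real s * coeff q i\<bar> \<le> real N * X" using 1 by (simp add: abs_mult)
    ultimately show ?thesis by (simp add: algebra_simps)
  qed
  \<comment> \<open>Each node costs the factor \<open>1 + 2 * (N + 1) = 2 * N + 3\<close>.\<close>
  also have "\<dots> \<le> M * (2 * real N + 3) ^ card S + (real N + 1) * X"
    using insert.prems(4) by (simp add: mult_le_cancel_left1)
  also have "\<dots> = M * (2 * real N + 3) ^ card (insert s S)"
    using insert.hyps by (simp add: X_def algebra_simps)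
  finally show ?case .
qed

text \<open>Removing the tangent at 0 leaves a nonnegative convex \<open>k\<close> that vanishes to
  second order at 0. Its values at the nodes \<open>0, ..., d + 1\<close> lie between 0 and the last
  one, so interpolation bounds the coefficient of \<open>t^2\<close> by that single value.\<close>

lemma convex_poly_growth:
  fixes h :: "real poly"
  assumes conv: "convex_on UNIV (poly h)" and deg: "degree h \<le> d"
  shows "coeff h 2 \<le> (2 * real d + 5) ^ (d + 2) *
      (poly h (real (d + 1)) - coeff h 0 - real (d + 1) * coeff h 1)" (is ?growth)
    and "0 \<le> coeff h 2"
proof -
  define k where "k = h - [:coeff h 0, coeff h 1:]"
  have pk: "poly k t = poly h t - coeff h 0 - t * coeff h 1" for t
    by (simp add: k_def)
  have h1: "poly (pderiv h) 0 = coeff h 1"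
    by (simp add: poly_0_coeff_0 coeff_pderiv)
  have k0: "0 \<le> poly k t" for t
  proof -
    have "poly h t - poly h 0 \<ge> poly (pderiv h) 0 * (t - 0)"
      by (rule convex_on_imp_above_tangent[OF conv]) (auto intro: poly_DERIV has_field_derivative_at_within)
    then show ?thesis unfolding h1 by (simp add: pk poly_0_coeff_0 algebra_simps)
  qed
  \<comment> \<open>The chord from 0 to \<open>d + 1\<close> lies above \<open>k\<close>, and
    \<open>k\<close> is 0 at 0.\<close>
  have kT: "poly k t \<le> poly k (real (d + 1))" if "0 \<le> t" "t \<le> real (d + 1)" for t
  proof -
    define l where "l = t / real (d + 1)"
    have l: "0 \<le> l" "l \<le> 1" "t = l * real (d + 1)" using that by (auto simp: l_def)
    have "poly h t \<le> (1 - l) * poly h 0 + l * poly h (real (d + 1))"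
      using convex_onD[OF conv l(1,2), of 0 "real (d + 1)"] l(3) by simp
    then have "poly k t \<le> l * poly k (real (d + 1))"
      by (simp add: pk poly_0_coeff_0 l(3) algebra_simps)
    also have "\<dots> \<le> 1 * poly k (real (d + 1))" using l k0 by (intro mult_right_mono) auto
    finally show ?thesis by simp
  qed
  have c2: "coeff k 2 = coeff h 2" by (simp add: k_def numeral_2_eq_2)
  \<comment> \<open>The tangent may have degree 1; \<open>d + 2\<close> nodes exceed
    \<open>max d 1\<close> even when \<open>d = 0\<close>.\<close>
  have degk: "degree k < card {..d + 1}"
  proof -
    have "degree k \<le> max (degree h) (degree [:coeff h 0, coeff h 1:])"
      unfolding k_def by (rule degree_diff_le_max)
    then show ?thesis using deg by (simp split: if_splits)
  qed
  have "\<bar>coeff k 2\<bar> \<le> poly k (real (d + 1)) * (2 * real (d + 1) + 3) ^ card {..d + 1}"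
    by (rule coeff_bound_of_values) (use degk kT k0 in auto)
  then show ?growth by (simp add: c2 pk algebra_simps)
  \<comment> \<open>The quotient of \<open>k\<close> by \<open>t^2\<close> is nonnegative away from
    0, and its limit at 0 is \<open>coeff k 2\<close>.\<close>
  obtain r where r: "k = [:0, 0, 1:] * r"
  proof
    have "coeff k 0 = 0" "coeff k (Suc 0) = 0" by (simp_all add: k_def)
    then show "k = [:0, 0, 1:] * poly_shift 2 k"
      by (intro poly_eqI) (auto simp: coeff_pCons coeff_poly_shift split: nat.split)
  qed
  have "0 \<le> poly r 0"
  proof (rule tendsto_lowerbound)
    show "((\<lambda>t. poly r t) \<longlongrightarrow> poly r 0) (at 0)" by (intro tendsto_intros)
    have "0 \<le> poly r t" if "t \<noteq> 0" for t
    proof -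
      have "0 \<le> t\<^sup>2 * poly r t" using k0[of t] by (simp add: r power2_eq_square mult_ac)
      then show ?thesis using that by (simp add: zero_le_mult_iff)
    qed
    then show "\<forall>\<^sub>F t in at 0. 0 \<le> poly r t" by (auto simp: eventually_at_filter)
  qed auto
  moreover have "coeff k 2 = poly r 0"
    by (simp add: r poly_0_coeff_0 numeral_2_eq_2)
  ultimately show "0 \<le> coeff h 2" using c2 by simp
qed

text \<open>Free one coordinate at a time: in each coordinate \<open>g\<close> is a polynomial of
  degree at most \<open>d\<close> with \<open>d + 1\<close> zeros.\<close>

lemma vanishes_of_vanishes_on_grid:
  fixes g :: "(nat \<Rightarrow> real) \<Rightarrow> real"
  assumes poly: "\<And>i x. i < n \<Longrightarrow> \<exists>p. degree p \<le> d \<and> (\<forall>t. g (x(i := t)) = poly p t)"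
    and zero: "\<And>x. x \<in> Rn n \<Longrightarrow> (\<And>i. i < n \<Longrightarrow> x i \<in> real ` {..d}) \<Longrightarrow> g x = 0"
    and x: "x \<in> Rn n"
  shows "g x = 0"
proof -
  \<comment> \<open>Claim for induction: the first \<open>k\<close> coordinates are arbitrary, the
    others are still on the grid.\<close>
  have "g x = 0" if "k \<le> n" "x \<in> Rn n" "\<And>i. k \<le> i \<Longrightarrow> i < n \<Longrightarrow> x i \<in> real ` {..d}" for k x
    using that
  proof (induction k arbitrary: x)
    case 0
    then show ?case using zero by simp
  next
    case (Suc k)
    obtain p where p: "degree p \<le> d" "\<And>t. g (x(k := t)) = poly p t"
      using poly[of k x] Suc.prems(1) by auto
    have root: "poly p t = 0" if "t \<in> real ` {..d}" for t
    proof -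
      have "g (x(k := t)) = 0"
        by (rule Suc.IH) (use Suc.prems that in \<open>auto simp: Rn_def\<close>)
      then show ?thesis by (simp add: p(2))
    qed
    have "p = 0"
    proof (rule ccontr)
      assume "p \<noteq> 0"
      then have "card {t. poly p t = 0} \<le> d" using card_poly_roots_bound[of p] p(1) by simp
      moreover have "card (real ` {..d}) \<le> card {t. poly p t = 0}"
        using root poly_roots_finite[OF \<open>p \<noteq> 0\<close>] by (intro card_mono) auto
      moreover have "card (real ` {..d}) = d + 1" by (simp add: card_image)
      ultimately show False by simp
    qed
    then show ?case using p(2)[of "x k"] by simp
  qed
  from this[of n x] x show ?thesis by simp
qed

section \<open>Polynomial functions of several variables\<close>

text \<open>Index and exponent vector are separate so that derivatives keep the index set
  \<open>I\<close> without collecting like terms. The semiring is arbitrary so that grid values can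
  be taken in the integers.\<close>

definition peval :: "nat \<Rightarrow> 'b set \<Rightarrow> ('b \<Rightarrow> 'a::comm_semiring_1) \<Rightarrow> ('b \<Rightarrow> nat \<Rightarrow> nat) \<Rightarrow> (nat \<Rightarrow> 'a) \<Rightarrow> 'a"
  where "peval n I c e x = (\<Sum>k\<in>I. c k * (\<Prod>i<n. x i ^ e k i))"

lemma of_int_peval:
  "(of_int (peval n I c e x) :: real) = peval n I (\<lambda>k. of_int (c k)) e (\<lambda>i. of_int (x i))"
  by (simp add: peval_def)

lemma abs_peval_le:
  fixes x :: "nat \<Rightarrow> real"
  assumes c: "\<And>k. k \<in> I \<Longrightarrow> \<bar>c k\<bar> \<le> C" and e: "\<And>k. k \<in> I \<Longrightarrow> (\<Sum>i<n. e k i) \<le> d"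
    and x: "\<And>i. i < n \<Longrightarrow> \<bar>x i\<bar> \<le> X" and X: "1 \<le> X"
  shows "\<bar>peval n I c e x\<bar> \<le> real (card I) * (C * X ^ d)"
proof -
  have mon: "\<bar>\<Prod>i<n. x i ^ e k i\<bar> \<le> X ^ d" if "k \<in> I" for k
  proof -
    have "\<bar>\<Prod>i<n. x i ^ e k i\<bar> = (\<Prod>i<n. \<bar>x i\<bar> ^ e k i)"
      by (simp add: abs_prod power_abs)
    also have "\<dots> \<le> (\<Prod>i<n. X ^ e k i)" using x by (intro prod_mono) (auto intro: power_mono)
    also have "\<dots> = X ^ (\<Sum>i<n. e k i)" by (simp add: power_sum)
    also have "\<dots> \<le> X ^ d" using X e[OF that] by (rule power_increasing[rotated])
    finally show ?thesis .
  qed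
  have "\<bar>peval n I c e x\<bar> \<le> (\<Sum>k\<in>I. \<bar>c k * (\<Prod>i<n. x i ^ e k i)\<bar>)"
    unfolding peval_def by (rule sum_abs)
  also have "\<dots> \<le> (\<Sum>k\<in>I. C * X ^ d)"
  proof (rule sum_mono)
    fix k assume k: "k \<in> I"
    show "\<bar>c k * (\<Prod>i<n. x i ^ e k i)\<bar> \<le> C * X ^ d"
      unfolding abs_mult using c[OF k] mon[OF k] by (intro mult_mono) auto
  qed
  finally show ?thesis by simp
qed

lemma peval_line_poly:
  fixes p u :: "nat \<Rightarrow> real"
  assumes e: "\<And>k. k \<in> I \<Longrightarrow> (\<Sum>i<n. e k i) \<le> d"
  shows "\<exists>h. degree h \<le> d \<and> (\<forall>t. poly h t = peval n I c e (\<lambda>i. p i + t * u i))"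
proof -
  define h where "h = (\<Sum>k\<in>I. Polynomial.smult (c k) (\<Prod>i<n. [:p i, u i:] ^ e k i))"
  have "degree (Polynomial.smult (c k) (\<Prod>i<n. [:p i, u i:] ^ e k i)) \<le> d" if "k \<in> I" for k
  proof -
    have "degree (Polynomial.smult (c k) (\<Prod>i<n. [:p i, u i:] ^ e k i))
        \<le> degree (\<Prod>i<n. [:p i, u i:] ^ e k i)" by (rule degree_smult_le)
    also have "\<dots> \<le> (\<Sum>i<n. degree ([:p i, u i:] ^ e k i))"
      using degree_prod_sum_le[of "{..<n}" "\<lambda>i. [:p i, u i:] ^ e k i"] by (simp add: o_def)
    also have "\<dots> \<le> (\<Sum>i<n. e k i)"
    proof (rule sum_mono)
      fix i
      have "degree ([:p i, u i:] ^ e k i) \<le> degree [:p i, u i:] * e k i" by (rule degree_power_le)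
      also have "\<dots> \<le> 1 * e k i" by (intro mult_right_mono) auto
      finally show "degree ([:p i, u i:] ^ e k i) \<le> e k i" by simp
    qed
    also have "\<dots> \<le> d" using e[OF that] .
    finally show ?thesis .
  qed
  then have "degree h \<le> d" unfolding h_def by (cases "finite I") (auto intro: degree_sum_le)
  moreover have "poly h t = peval n I c e (\<lambda>i. p i + t * u i)" for t
    by (simp add: h_def peval_def poly_sum poly_prod)
  ultimately show ?thesis by blast
qed

text \<open>The exponents of a partial derivative. Truncated subtraction at 0 is harmless, as the
  coefficient then carries the factor \<open>e i = 0\<close>.\<close>

definition dec :: "nat \<Rightarrow> (nat \<Rightarrow> nat) \<Rightarrow> nat \<Rightarrow> nat" where
  "dec i e = e(i := e i - 1)"

lemma sum_dec_le: "(\<Sum>i<n. dec j e i) \<le> (\<Sum>i<n. e i)"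
  by (intro sum_mono) (simp add: dec_def)

lemma peval_has_derivative_line:
  fixes p u :: "nat \<Rightarrow> real"
  shows "((\<lambda>t. peval n I c e (\<lambda>i. p i + t * u i)) has_real_derivative
    (\<Sum>i<n. u i * peval n I (\<lambda>k. c k * real (e k i)) (\<lambda>k. dec i (e k)) (\<lambda>i. p i + t * u i))) (at t)"
proof -
  let ?x = "\<lambda>i. p i + t * u i"
  have mon: "((\<lambda>t. \<Prod>i<n. (p i + t * u i) ^ e k i) has_real_derivative
      (\<Sum>i<n. u i * real (e k i) * (\<Prod>j<n. ?x j ^ dec i (e k) j))) (at t)" for k
  proof -
    have "((\<lambda>t. \<Prod>i<n. (p i + t * u i) ^ e k i) has_real_derivative
      (\<Sum>i<n. (real (e k i) * ?x i ^ (e k i - 1) * u i) * (\<Prod>j\<in>{..<n} - {i}. ?x j ^ e k j))) (at t)"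
      by (rule has_field_derivative_prod) (auto intro!: derivative_eq_intros)
    moreover have "(\<Sum>i<n. (real (e k i) * ?x i ^ (e k i - 1) * u i) * (\<Prod>j\<in>{..<n} - {i}. ?x j ^ e k j))
      = (\<Sum>i<n. u i * real (e k i) * (\<Prod>j<n. ?x j ^ dec i (e k) j))"
    proof (intro sum.cong refl)
      fix i assume i: "i \<in> {..<n}"
      have "(\<Prod>j<n. ?x j ^ dec i (e k) j)
          = ?x i ^ dec i (e k) i * (\<Prod>j\<in>{..<n} - {i}. ?x j ^ dec i (e k) j)"
        using i by (intro prod.remove) auto
      also have "(\<Prod>j\<in>{..<n} - {i}. ?x j ^ dec i (e k) j) = (\<Prod>j\<in>{..<n} - {i}. ?x j ^ e k j)"
        by (intro prod.cong refl) (simp add: dec_def)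
      finally have eq: "(\<Prod>j<n. ?x j ^ dec i (e k) j)
          = ?x i ^ (e k i - 1) * (\<Prod>j\<in>{..<n} - {i}. ?x j ^ e k j)"
        by (simp add: dec_def)
      show "(real (e k i) * ?x i ^ (e k i - 1) * u i) * (\<Prod>j\<in>{..<n} - {i}. ?x j ^ e k j)
          = u i * real (e k i) * (\<Prod>j<n. ?x j ^ dec i (e k) j)"
        unfolding eq by (simp only: mult_ac)
    qed
    ultimately show ?thesis by simp
  qed
  have "((\<lambda>t. peval n I c e (\<lambda>i. p i + t * u i)) has_real_derivative
      (\<Sum>k\<in>I. c k * (\<Sum>i<n. u i * real (e k i) * (\<Prod>j<n. ?x j ^ dec i (e k) j)))) (at t)"
    unfolding peval_def by (intro DERIV_sum DERIV_cmult mon)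
  moreover have "(\<Sum>k\<in>I. c k * (\<Sum>i<n. u i * real (e k i) * (\<Prod>j<n. ?x j ^ dec i (e k) j)))
    = (\<Sum>i<n. u i * peval n I (\<lambda>k. c k * real (e k i)) (\<lambda>k. dec i (e k)) ?x)"
    unfolding peval_def sum_distrib_left
    by (subst sum.swap) (intro sum.cong refl, simp only: mult_ac)
  ultimately show ?thesis by simp
qed

definition grid :: "nat \<Rightarrow> nat \<Rightarrow> (nat \<Rightarrow> nat) set" where
  "grid n d = {p. (\<forall>i<n. p i \<le> d) \<and> (\<forall>i\<ge>n. p i = 0)}"

lemma finite_grid: "finite (grid n d)" and card_grid_le: "card (grid n d) \<le> (d + 1) ^ n"
proof -
  let ?P = "PiE {..<n} (\<lambda>_. {..d})"
  let ?r = "\<lambda>g i. if i < n then g i else 0"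
  have fin: "finite ?P" by (intro finite_PiE) auto
  have sub: "grid n d \<subseteq> ?r ` ?P"
  proof
    fix p assume p: "p \<in> grid n d"
    have "p = ?r (restrict p {..<n})" using p by (auto simp: grid_def)
    moreover have "restrict p {..<n} \<in> ?P" using p by (auto simp: grid_def)
    ultimately show "p \<in> ?r ` ?P" by blast
  qed
  show "finite (grid n d)" using sub fin finite_surj by blast
  have "card (grid n d) \<le> card (?r ` ?P)" using sub fin by (intro card_mono) auto
  also have "\<dots> \<le> card ?P" using fin by (rule card_image_le)
  also have "\<dots> = (d + 1) ^ n" by (simp add: card_PiE)
  finally show "card (grid n d) \<le> (d + 1) ^ n" .
qed

lemma real_grid_in_Rn: "p \<in> grid n d \<Longrightarrow> (\<lambda>i. real (p i)) \<in> Rn n"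
  by (simp add: grid_def Rn_def)

lemma grid_nonempty: "grid n d \<noteq> {}"
  by (auto simp: grid_def intro!: exI[of _ "\<lambda>_. 0"])

section \<open>Growth of convex polynomials\<close>

text \<open>The situation after clearing denominators; each exponent vector is its own
  index.\<close>

locale convex_int_poly =
  fixes n d :: nat and I :: "(nat \<Rightarrow> nat) set" and c :: "(nat \<Rightarrow> nat) \<Rightarrow> int" and C :: real
  assumes degree_le: "\<alpha> \<in> I \<Longrightarrow> (\<Sum>i<n. \<alpha> i) \<le> d"
    and coeff_le: "\<alpha> \<in> I \<Longrightarrow> \<bar>real_of_int (c \<alpha>)\<bar> \<le> C"
    and convex: "x \<in> Rn n \<Longrightarrow> y \<in> Rn n \<Longrightarrow> 0 \<le> t \<Longrightarrow> t \<le> 1 \<Longrightarrow>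
      peval n I (\<lambda>\<alpha>. real_of_int (c \<alpha>)) (\<lambda>\<alpha>. \<alpha>) (\<lambda>i. t * x i + (1 - t) * y i)
      \<le> t * peval n I (\<lambda>\<alpha>. real_of_int (c \<alpha>)) (\<lambda>\<alpha>. \<alpha>) x
        + (1 - t) * peval n I (\<lambda>\<alpha>. real_of_int (c \<alpha>)) (\<lambda>\<alpha>. \<alpha>) y"
begin

definition F :: "(nat \<Rightarrow> real) \<Rightarrow> real" where
  "F = peval n I (\<lambda>\<alpha>. real_of_int (c \<alpha>)) (\<lambda>\<alpha>. \<alpha>)"

definition grad :: "nat \<Rightarrow> (nat \<Rightarrow> real) \<Rightarrow> real" where
  "grad i = peval n I (\<lambda>\<alpha>. real_of_int (c \<alpha>) * real (\<alpha> i)) (dec i)"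

text \<open>\<open>dec i \<alpha> j\<close> is \<open>\<alpha> j\<close> off the diagonal and
  \<open>\<alpha> i - 1\<close> on it (truncated), so one formula covers pure and mixed second
  derivatives.\<close>

definition hess_coeff :: "nat \<Rightarrow> nat \<Rightarrow> (nat \<Rightarrow> nat) \<Rightarrow> int" where
  "hess_coeff i j \<alpha> = c \<alpha> * int (\<alpha> i) * int (dec i \<alpha> j)"

definition hess :: "nat \<Rightarrow> nat \<Rightarrow> (nat \<Rightarrow> real) \<Rightarrow> real" where
  "hess i j = peval n I (\<lambda>\<alpha>. real_of_int (hess_coeff i j \<alpha>)) (\<lambda>\<alpha>. dec j (dec i \<alpha>))"

definition hess_form :: "(nat \<Rightarrow> real) \<Rightarrow> (nat \<Rightarrow> real) \<Rightarrow> real" where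
  "hess_form x u = (\<Sum>i<n. \<Sum>j<n. u i * u j * hess i j x)"

text \<open>Evaluated over the integers, so that the rows of \<open>G\<close> are admissible vectors
  in \<open>small_solution\<close>.\<close>

definition G :: "nat \<Rightarrow> nat \<Rightarrow> int" where
  "G i j = (\<Sum>p\<in>grid n d. peval n I (hess_coeff i j) (\<lambda>\<alpha>. dec j (dec i \<alpha>)) (\<lambda>k. int (p k)))"

definition q :: "(nat \<Rightarrow> real) \<Rightarrow> real" where
  "q u = (\<Sum>i<n. u i * dot n (G i) u)"

lemma F_convex: "x \<in> Rn n \<Longrightarrow> y \<in> Rn n \<Longrightarrow> 0 \<le> t \<Longrightarrow> t \<le> 1 \<Longrightarrow>
    F (\<lambda>i. t * x i + (1 - t) * y i) \<le> t * F x + (1 - t) * F y"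
  unfolding F_def by (rule convex)

lemma hess_commute: "hess i j = hess j i"
proof -
  have "hess_coeff i j \<alpha> = hess_coeff j i \<alpha>" for \<alpha>
    by (cases "i = j") (auto simp: hess_coeff_def dec_def)
  moreover have "dec j (dec i \<alpha>) = dec i (dec j \<alpha>)" for \<alpha>
    by (auto simp: dec_def fun_eq_iff)
  ultimately show ?thesis by (simp add: hess_def)
qed

lemma of_int_G: "real_of_int (G i j) = (\<Sum>p\<in>grid n d. hess i j (\<lambda>k. real (p k)))"
  by (simp add: G_def hess_def of_int_peval)

lemma G_commute: "G i j = G j i"
proof -
  have "real_of_int (G i j) = real_of_int (G j i)"
    unfolding of_int_G by (simp add: hess_commute[of i j])
  then show ?thesis by simp
qed

lemma q_eq: "q u = (\<Sum>p\<in>grid n d. hess_form (\<lambda>k. real (p k)) u)"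
proof -
  have "q u = (\<Sum>i<n. \<Sum>j<n. \<Sum>p\<in>grid n d. u i * u j * hess i j (\<lambda>k. real (p k)))"
    by (simp add: q_def dot_def of_int_G sum_distrib_left sum_distrib_right mult_ac)
  also have "\<dots> = (\<Sum>i<n. \<Sum>p\<in>grid n d. \<Sum>j<n. u i * u j * hess i j (\<lambda>k. real (p k)))"
    by (intro sum.cong refl sum.swap)
  also have "\<dots> = (\<Sum>p\<in>grid n d. hess_form (\<lambda>k. real (p k)) u)"
    unfolding hess_form_def by (rule sum.swap)
  finally show ?thesis .
qed

text \<open>Uniqueness of derivatives identifies the Taylor coefficients of \<open>F\<close> along a
  line with gradient and Hessian; this brings the univariate results to several variables.\<close>

lemma line_poly:
  obtains h where "degree h \<le> d" "\<forall>t. poly h t = F (\<lambda>i. p i + t * u i)"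
    "coeff h 0 = F p" "coeff h 1 = (\<Sum>i<n. u i * grad i p)" "2 * coeff h 2 = hess_form p u"
    "\<forall>t. poly (pderiv (pderiv h)) t = hess_form (\<lambda>i. p i + t * u i) u"
proof -
  obtain h where h: "degree h \<le> d" "\<forall>t. poly h t = F (\<lambda>i. p i + t * u i)"
    using peval_line_poly[of I "\<lambda>\<alpha>. \<alpha>" n d "\<lambda>\<alpha>. real_of_int (c \<alpha>)" p u] degree_le
    unfolding F_def by blast
  have d1: "poly (pderiv h) t = (\<Sum>i<n. u i * grad i (\<lambda>i. p i + t * u i))" for t
  proof (rule DERIV_unique[OF poly_DERIV])
    have "poly h = (\<lambda>t. F (\<lambda>i. p i + t * u i))" using h(2) by auto
    then show "(poly h has_real_derivative (\<Sum>i<n. u i * grad i (\<lambda>i. p i + t * u i))) (at t)"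
      unfolding F_def grad_def by (simp only: peval_has_derivative_line)
  qed
  have d2: "poly (pderiv (pderiv h)) t = hess_form (\<lambda>i. p i + t * u i) u" for t
  proof (rule DERIV_unique[OF poly_DERIV])
    have eq: "poly (pderiv h) = (\<lambda>t. \<Sum>i<n. u i * grad i (\<lambda>i. p i + t * u i))" using d1 by auto
    have g: "((\<lambda>t. grad i (\<lambda>i. p i + t * u i)) has_real_derivative
        (\<Sum>j<n. u j * hess i j (\<lambda>i. p i + t * u i))) (at t)" for i
      using peval_has_derivative_line[of n I "\<lambda>\<alpha>. real_of_int (c \<alpha>) * real (\<alpha> i)" "dec i" p u t]
      by (simp add: grad_def hess_def hess_coeff_def)
    have "((\<lambda>t. \<Sum>i<n. u i * grad i (\<lambda>i. p i + t * u i)) has_real_derivative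
        (\<Sum>i<n. u i * (\<Sum>j<n. u j * hess i j (\<lambda>i. p i + t * u i)))) (at t)"
      by (intro DERIV_sum DERIV_cmult g)
    then show "(poly (pderiv h) has_real_derivative hess_form (\<lambda>i. p i + t * u i) u) (at t)"
      unfolding eq by (simp add: hess_form_def sum_distrib_left mult_ac)
  qed
  show ?thesis
  proof (rule that[OF h])
    show "coeff h 0 = F p" using h(2)[rule_format, of 0] by (simp add: poly_0_coeff_0)
    show "coeff h 1 = (\<Sum>i<n. u i * grad i p)"
      using d1[of 0] by (simp add: poly_0_coeff_0 coeff_pderiv)
    show "2 * coeff h 2 = hess_form p u"
      using d2[of 0] by (simp add: poly_0_coeff_0 coeff_pderiv numeral_2_eq_2)
    show "\<forall>t. poly (pderiv (pderiv h)) t = hess_form (\<lambda>i. p i + t * u i) u" using d2 by blast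
  qed
qed

lemma convex_line:
  assumes "p \<in> Rn n" "u \<in> Rn n" "\<forall>t. poly h t = F (\<lambda>i. p i + t * u i)"
  shows "convex_on UNIV (poly h)"
proof (rule convex_onI)
  fix t x y :: real assume t: "0 < t" "t < 1"
  \<comment> \<open>\<open>convex_onI\<close> gives the weight \<open>t\<close> to the second point,
    hence the exchanged order of \<open>x\<close> and \<open>y\<close>.\<close>
  have "F (\<lambda>i. t * (p i + y * u i) + (1 - t) * (p i + x * u i))
      \<le> t * F (\<lambda>i. p i + y * u i) + (1 - t) * F (\<lambda>i. p i + x * u i)"
    using t assms by (intro F_convex Rn_add_scale) auto
  moreover have "(\<lambda>i. t * (p i + y * u i) + (1 - t) * (p i + x * u i))
      = (\<lambda>i. p i + ((1 - t) *\<^sub>R x + t *\<^sub>R y) * u i)"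
    by (simp add: fun_eq_iff algebra_simps)
  ultimately show "poly h ((1 - t) *\<^sub>R x + t *\<^sub>R y) \<le> (1 - t) * poly h x + t * poly h y"
    using assms(3) by simp
qed auto

lemma hess_form_nonneg:
  assumes "p \<in> Rn n" "u \<in> Rn n"
  shows "0 \<le> hess_form p u"
proof -
  obtain h where h: "degree h \<le> d" "\<forall>t. poly h t = F (\<lambda>i. p i + t * u i)"
    "2 * coeff h 2 = hess_form p u"
    by (rule line_poly[of p u])
  show ?thesis using convex_poly_growth(2)[OF convex_line[OF assms h(2)] h(1)] h(3) by simp
qed

lemma q_nonneg: "u \<in> Rn n \<Longrightarrow> 0 \<le> q u"
  unfolding q_eq by (intro sum_nonneg hess_form_nonneg real_grid_in_Rn)

lemma dec_dec_le: "\<alpha> \<in> I \<Longrightarrow> (\<Sum>i<n. dec j (dec k \<alpha>) i) \<le> d"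
  by (meson degree_le order_trans sum_dec_le)

text \<open>\<open>q u\<close> is a sum of nonnegative curvatures at the grid points, so all of
  these vanish; as a function of \<open>x\<close> the curvature is a polynomial of degree at most
  \<open>d\<close> in each coordinate.\<close>

lemma hess_form_zero:
  assumes u: "u \<in> Rn n" and q0: "q u = 0" and x: "x \<in> Rn n"
  shows "hess_form x u = 0"
proof (rule vanishes_of_vanishes_on_grid[of n d "\<lambda>x. hess_form x u", OF _ _ x])
  fix i and x :: "nat \<Rightarrow> real" assume "i < n"
  let ?e = "\<lambda>k. if k = i then 1 else 0 :: real"
  have "\<exists>h. degree h \<le> d \<and> (\<forall>t. poly h t = hess j k (\<lambda>l. (x(i := 0)) l + t * ?e l))" for j k
    unfolding hess_def by (rule peval_line_poly) (rule dec_dec_le)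
  then obtain h where h: "\<And>j k. degree (h j k) \<le> d"
    "\<And>j k t. poly (h j k) t = hess j k (\<lambda>l. (x(i := 0)) l + t * ?e l)" by metis
  define p where "p = (\<Sum>j<n. \<Sum>k<n. Polynomial.smult (u j * u k) (h j k))"
  have "degree p \<le> d"
    unfolding p_def by (intro degree_sum_le order_trans[OF degree_smult_le] h(1)) auto
  moreover have "hess_form (x(i := t)) u = poly p t" for t
  proof -
    have "x(i := t) = (\<lambda>l. (x(i := 0)) l + t * ?e l)" by (auto simp: fun_eq_iff)
    then show ?thesis by (simp add: hess_form_def p_def poly_sum h(2))
  qed
  ultimately show "\<exists>p. degree p \<le> d \<and> (\<forall>t. hess_form (x(i := t)) u = poly p t)" by blast
next
  fix x :: "nat \<Rightarrow> real" assume x: "x \<in> Rn n" "\<And>i. i < n \<Longrightarrow> x i \<in> real ` {..d}"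
  have zero: "\<forall>p\<in>grid n d. hess_form (\<lambda>k. real (p k)) u = 0"
    using q0 unfolding q_eq
    by (subst (asm) sum_nonneg_eq_0_iff) (auto intro: hess_form_nonneg u real_grid_in_Rn finite_grid)
  define p where "p i = nat \<lfloor>x i\<rfloor>" for i
  have xp: "x i = real (p i)" for i
  proof (cases "i < n")
    case True
    then show ?thesis using x(2)[OF True] by (auto simp: p_def)
  next
    case False
    then show ?thesis using x(1) by (simp add: p_def Rn_def)
  qed
  have "p \<in> grid n d"
  proof -
    have "p i \<le> d" if "i < n" for i using x(2)[OF that] by (auto simp: xp)
    moreover have "p i = 0" if "i \<ge> n" for i using x(1) that by (simp add: p_def Rn_def)
    ultimately show ?thesis by (simp add: grid_def)
  qed
  moreover have "x = (\<lambda>k. real (p k))" using xp by auto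
  ultimately show "hess_form x u = 0" using zero by simp
qed

text \<open>Here \<open>q u = 0\<close>, so the second derivative of \<open>F\<close> along
  \<open>u\<close> vanishes on the whole line.\<close>

lemma F_affine:
  assumes y: "y \<in> Rn n" and u: "u \<in> Rn n" and ker: "\<And>i. i < n \<Longrightarrow> dot n (G i) u = 0"
  shows "\<exists>s. \<forall>t. F (\<lambda>i. y i + t * u i) = F y + s * t"
proof -
  have q0: "q u = 0" using ker by (simp add: q_def)
  obtain h where h: "\<forall>t. poly h t = F (\<lambda>i. y i + t * u i)" "coeff h 0 = F y"
    "\<forall>t. poly (pderiv (pderiv h)) t = hess_form (\<lambda>i. y i + t * u i) u"
    by (rule line_poly[of y u])
  have "\<forall>t. poly (pderiv (pderiv h)) t = 0"
    using h(3) hess_form_zero[OF u q0 Rn_add_scale[OF y u]] by simp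
  then have "pderiv (pderiv h) = 0" by (simp add: poly_all_0_iff_0)
  then have "degree h \<le> 1" by (simp add: pderiv_eq_0_iff degree_pderiv)
  then have "h = [:coeff h 0, coeff h 1:]"
    by (intro poly_eqI) (auto simp: coeff_pCons coeff_eq_0 split: nat.split)
  then have "poly h t = coeff h 0 + t * coeff h 1" for t
    by (metis poly_pCons poly_0 mult_zero_right add_0_right)
  then show ?thesis using h(1,2) by (intro exI[of _ "coeff h 1"]) (simp add: mult.commute)
qed

text \<open>The Cauchy-Schwarz inequality of the semidefinite form \<open>q\<close> for
  \<open>v\<close> and the unit vector \<open>e\<close>. The positive bound \<open>E\<close>
  replaces the diagonal entry, which may be zero.\<close>

lemma dot_G_square_le:
  assumes v: "v \<in> Rn n" and i: "i < n" and E: "real_of_int (G i i) \<le> E" "0 < E"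
  shows "(dot n (G i) v)\<^sup>2 \<le> E * q v"
proof -
  define g where "g = dot n (G i) v"
  \<comment> \<open>The minimizer of \<open>q v + 2 * s * g + s^2 * E\<close>.\<close>
  define s where "s = - g / E"
  define e where "e = (\<lambda>k. if k = i then 1 else 0 :: real)"
  have eR: "e \<in> Rn n" using i by (simp add: Rn_def e_def)
  have sum_e: "(\<Sum>k<n. e k * f k) = f i" for f :: "nat \<Rightarrow> real"
  proof -
    have "e k * f k = (if k = i then f k else 0)" for k by (simp add: e_def)
    then show ?thesis using i by simp
  qed
  have dote: "dot n a e = real_of_int (a i)" for a
    using sum_e[of "\<lambda>k. real_of_int (a k)"] by (simp add: dot_def mult.commute)
  have gsum: "(\<Sum>k<n. v k * real_of_int (G k i)) = g"
    by (simp add: g_def dot_def G_commute[of i] mult.commute)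
  have "q (\<lambda>k. v k + s * e k)
      = (\<Sum>k<n. v k * dot n (G k) v + s * (v k * real_of_int (G k i)) + s * (e k * dot n (G k) v)
          + s\<^sup>2 * (e k * real_of_int (G k i)))"
    unfolding q_def by (intro sum.cong refl) (simp add: dot_add_scale dote power2_eq_square algebra_simps)
  also have "\<dots> = q v + s * g + s * g + s\<^sup>2 * real_of_int (G i i)"
    by (simp add: sum.distrib sum_distrib_left[symmetric] gsum sum_e q_def g_def[symmetric])
  also have "\<dots> \<le> q v + s * g + s * g + s\<^sup>2 * E" using E(1) by (simp add: mult_left_mono)
  also have "\<dots> = q v - g\<^sup>2 / E" using E(2) by (simp add: s_def field_simps power2_eq_square)
  finally have "0 \<le> q v - g\<^sup>2 / E"
    using q_nonneg[OF Rn_add_scale[OF v eR], of s] by linarith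
  then show ?thesis using E(2) by (simp add: g_def field_simps)
qed

lemma abs_F_le: "(\<And>i. i < n \<Longrightarrow> \<bar>x i\<bar> \<le> X) \<Longrightarrow> 1 \<le> X \<Longrightarrow> \<bar>F x\<bar> \<le> real (card I) * (C * X ^ d)"
  unfolding F_def by (rule abs_peval_le) (auto intro: coeff_le degree_le)

lemma component_le: "\<alpha> \<in> I \<Longrightarrow> i < n \<Longrightarrow> \<alpha> i \<le> d"
  using degree_le[of \<alpha>] member_le_sum[of i "{..<n}" \<alpha>] by simp

lemma abs_grad_le:
  assumes i: "i < n" and x: "\<And>i. i < n \<Longrightarrow> \<bar>x i\<bar> \<le> X" "1 \<le> X"
  shows "\<bar>grad i x\<bar> \<le> real (card I) * (C * real d * X ^ d)"
  unfolding grad_def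
proof (rule abs_peval_le)
  show "\<bar>real_of_int (c \<alpha>) * real (\<alpha> i)\<bar> \<le> C * real d" if "\<alpha> \<in> I" for \<alpha>
    unfolding abs_mult using coeff_le[OF that] component_le[OF that i] by (intro mult_mono) auto
  show "(\<Sum>k<n. dec i \<alpha> k) \<le> d" if "\<alpha> \<in> I" for \<alpha>
    by (meson degree_le order_trans sum_dec_le that)
qed (use x in auto)

text \<open>There are at most \<open>(d + 1) ^ n\<close> grid points, and two differentiations cost
  \<open>d^2\<close>. Coordinates are bounded by \<open>d + 1\<close> instead of \<open>d\<close> to
  have a base of at least 1.\<close>

lemma abs_G_le:
  assumes i: "i < n" and j: "j < n" and C0: "0 \<le> C"
  shows "\<bar>real_of_int (G i j)\<bar> \<le> real (d + 1) ^ n * (real (card I) * (C * (real d)\<^sup>2 * real (d + 1) ^ d))"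
proof -
  define B where "B = real (card I) * (C * (real d)\<^sup>2 * real (d + 1) ^ d)"
  have B0: "0 \<le> B" using C0 by (simp add: B_def)
  have "\<bar>real_of_int (G i j)\<bar> \<le> (\<Sum>p\<in>grid n d. \<bar>hess i j (\<lambda>k. real (p k))\<bar>)"
    unfolding of_int_G by (rule sum_abs)
  also have "\<dots> \<le> (\<Sum>p\<in>grid n d. B)"
  proof (rule sum_mono)
    fix p assume p: "p \<in> grid n d"
    show "\<bar>hess i j (\<lambda>k. real (p k))\<bar> \<le> B"
      unfolding hess_def B_def
    proof (rule abs_peval_le)
      show "\<bar>real_of_int (hess_coeff i j \<alpha>)\<bar> \<le> C * (real d)\<^sup>2" if "\<alpha> \<in> I" for \<alpha>
      proof -
        have "dec i \<alpha> j \<le> d" using component_le[OF that j] by (auto simp: dec_def)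
        then have "\<bar>real_of_int (c \<alpha>)\<bar> * (real (\<alpha> i) * real (dec i \<alpha> j)) \<le> C * (real d * real d)"
          using coeff_le[OF that] component_le[OF that i] by (intro mult_mono) auto
        then show ?thesis by (simp add: hess_coeff_def abs_mult power2_eq_square mult_ac)
      qed
    qed (use p in \<open>auto simp: grid_def intro: dec_dec_le le_SucI\<close>)
  qed
  also have "\<dots> = real (card (grid n d)) * B" by simp
  also have "\<dots> \<le> real ((d + 1) ^ n) * B"
    using B0 card_grid_le[of n d] by (intro mult_right_mono of_nat_mono) auto
  finally show ?thesis by (simp add: B_def)
qed

text \<open>In the denominator, \<open>4 * (d + 1)^2\<close> comes from scaling the direction,
  \<open>(d + 1) ^ n\<close> from selecting one grid point, and the last factor from
  \<open>convex_poly_growth\<close>.\<close>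

lemma F_growth:
  assumes x: "x \<in> Rn n" and X: "\<And>i. i < n \<Longrightarrow> \<bar>x i\<bar> \<le> X" "0 \<le> X" and C0: "0 \<le> C"
  shows "q x / (4 * real (d + 1) ^ (n + 2) * (2 * real d + 5) ^ (d + 2))
    - 3 * (real n + 1) * (real (card I) * C * (2 * real d + 2) ^ (d + 1)) * (1 + X) \<le> F x"
proof -
  \<comment> \<open>\<open>p + x/2\<close> is the midpoint of \<open>2p\<close> and \<open>x\<close>, so growth along the line through the grid point \<open>p\<close>
    in direction \<open>x\<close> forces growth at \<open>x\<close> itself.\<close>
  define N where "N = real (d + 1)"
  \<comment> \<open>Scaled so that the parameter \<open>N\<close>, where
    \<open>convex_poly_growth\<close> evaluates, leads to \<open>p + x/2\<close>.\<close>
  define u where "u i = x i / (2 * N)" for i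
  have N1: "1 \<le> N" by (simp add: N_def)
  have uR: "u \<in> Rn n" using x by (simp add: Rn_def u_def)
  have qu: "q u = q x / (4 * N\<^sup>2)"
  proof -
    have "dot n a u = dot n a x / (2 * N)" for a
      by (simp add: dot_def u_def sum_divide_distrib)
    then have "q u = (\<Sum>i<n. x i * dot n (G i) x / (4 * N\<^sup>2))"
      unfolding q_def by (simp add: u_def power2_eq_square mult_ac)
    then show ?thesis by (simp add: q_def sum_divide_distrib)
  qed
  \<comment> \<open>Averaging: \<open>q u\<close> is a sum of at most \<open>N ^ n\<close>
    curvatures.\<close>
  have "\<exists>p\<in>grid n d. q u \<le> N ^ n * hess_form (\<lambda>k. real (p k)) u"
  proof (rule ccontr)
    assume "\<not> ?thesis"
    then have less: "N ^ n * hess_form (\<lambda>k. real (p k)) u < q u" if "p \<in> grid n d" for p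
      using that by (simp add: not_le)
    have "N ^ n * q u = (\<Sum>p\<in>grid n d. N ^ n * hess_form (\<lambda>k. real (p k)) u)"
      by (simp add: q_eq sum_distrib_left)
    also have "\<dots> < (\<Sum>p\<in>grid n d. q u)"
      using less finite_grid grid_nonempty by (intro sum_strict_mono)
    also have "\<dots> \<le> N ^ n * q u"
    proof -
      have "real (card (grid n d)) \<le> N ^ n"
        using of_nat_mono[OF card_grid_le[of n d], where 'a = real] by (simp add: N_def)
      then show ?thesis using q_nonneg[OF uR] by (simp add: mult_right_mono)
    qed
    finally show False by simp
  qed
  then obtain p where p: "p \<in> grid n d" "q u \<le> N ^ n * hess_form (\<lambda>k. real (p k)) u" by blast
  let ?p = "\<lambda>k. real (p k)"
  have pR: "?p \<in> Rn n" using p(1) by (rule real_grid_in_Rn)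
  have ple: "\<bar>?p i\<bar> \<le> N" if "i < n" for i using p(1) that by (auto simp: grid_def N_def le_SucI)
  have ple2: "\<bar>?p i\<bar> \<le> 2 * N" if "i < n" for i using ple[OF that] N1 by linarith
  obtain h where h: "degree h \<le> d" "\<forall>t. poly h t = F (\<lambda>i. ?p i + t * u i)"
    "coeff h 0 = F ?p" "coeff h 1 = (\<Sum>i<n. u i * grad i ?p)" "2 * coeff h 2 = hess_form ?p u"
    by (rule line_poly[of ?p u])
  define K where "K = (2 * real d + 5) ^ (d + 2)"
  have K0: "0 < K" by (simp add: K_def)
  have "coeff h 2 \<le> K * (poly h N - coeff h 0 - N * coeff h 1)"
    using convex_poly_growth(1)[OF convex_line[OF pR uR h(2)] h(1)] by (simp add: K_def N_def)
  then have g1: "hess_form ?p u / (2 * K) \<le> poly h N - coeff h 0 - N * coeff h 1"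
    using K0 h(5) by (simp add: field_simps)
  \<comment> \<open>Bounds \<open>F\<close> at both \<open>p\<close> and \<open>2p\<close>, whose
    coordinates are at most \<open>2 * N\<close>.\<close>
  define M where "M = real (card I) * (C * (2 * N) ^ d)"
  have M0: "0 \<le> M" using C0 N1 by (simp add: M_def)
  have g2: "poly h N \<le> 1/2 * F (\<lambda>i. 2 * ?p i) + 1/2 * F x"
  proof -
    have "F (\<lambda>i. 1/2 * (2 * ?p i) + (1 - 1/2) * x i)
        \<le> 1/2 * F (\<lambda>i. 2 * ?p i) + (1 - 1/2) * F x"
      using pR x by (intro F_convex) (auto simp: Rn_def)
    moreover have "(\<lambda>i. 1/2 * (2 * ?p i) + (1 - 1/2) * x i) = (\<lambda>i. ?p i + N * u i)"
      using N1 by (simp add: fun_eq_iff u_def)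
    ultimately show ?thesis using h(2) by simp
  qed
  have b1: "F (\<lambda>i. 2 * ?p i) \<le> M"
  proof -
    have "\<bar>F (\<lambda>i. 2 * ?p i)\<bar> \<le> M"
      unfolding M_def by (rule abs_F_le) (use ple N1 in auto)
    then show ?thesis by simp
  qed
  have b2: "- M \<le> coeff h 0"
  proof -
    have "\<bar>F ?p\<bar> \<le> M"
      unfolding M_def by (rule abs_F_le) (use ple2 N1 in auto)
    then show ?thesis using h(3) by simp
  qed
  have b3: "- (real n * X * (M * (2 * N))) \<le> 2 * N * coeff h 1"
  proof -
    have "2 * N * coeff h 1 = (\<Sum>i<n. x i * grad i ?p)"
      using N1 unfolding h(4) by (simp add: u_def sum_distrib_left)
    moreover have "\<bar>\<Sum>i<n. x i * grad i ?p\<bar> \<le> (\<Sum>i<n. X * (M * (2 * N)))"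
    proof (rule order_trans[OF sum_abs sum_mono])
      fix i assume i: "i \<in> {..<n}"
      have "\<bar>grad i ?p\<bar> \<le> real (card I) * (C * real d * (2 * N) ^ d)"
        using i by (intro abs_grad_le) (use ple2 N1 in auto)
      also have "\<dots> = M * real d" by (simp add: M_def)
      also have "\<dots> \<le> M * (2 * N)" using M0 by (intro mult_left_mono) (auto simp: N_def)
      finally show "\<bar>x i * grad i ?p\<bar> \<le> X * (M * (2 * N))"
        unfolding abs_mult using X i by (intro mult_mono) auto
    qed
    ultimately show ?thesis by simp
  qed
  have "hess_form ?p u / K \<le> 2 * poly h N - 2 * coeff h 0 - 2 * N * coeff h 1"
    using mult_left_mono[OF g1, of 2] by (simp add: algebra_simps)
  \<comment> \<open>\<open>F\<close> at \<open>2p\<close> contributes \<open>M\<close>, and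
    \<open>coeff h 0\<close> contributes \<open>2 * M\<close>.\<close>
  also have "\<dots> \<le> F x + 3 * M + real n * X * (M * (2 * N))" using g2 b1 b2 b3 by linarith
  finally have low: "hess_form ?p u / K - 3 * M - real n * X * (M * (2 * N)) \<le> F x" by simp
  have "q x / (4 * N ^ (n + 2) * K) \<le> hess_form ?p u / K"
  proof -
    have "q x = 4 * N\<^sup>2 * q u" using N1 by (simp add: qu)
    also have "\<dots> \<le> 4 * N\<^sup>2 * (N ^ n * hess_form ?p u)"
      using p(2) by (intro mult_left_mono) auto
    finally have "q x \<le> 4 * N ^ (n + 2) * hess_form ?p u"
      by (simp add: power_add power2_eq_square mult_ac)
    then show ?thesis using K0 N1 by (simp add: field_simps)
  qed
  moreover have "3 * M + real n * X * (M * (2 * N)) \<le> 3 * (real n + 1) * (M * (2 * N)) * (1 + X)"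
  proof -
    define W where "W = M * (2 * N)"
    have MW: "M \<le> W" using M0 N1 by (simp add: W_def mult_le_cancel_left1)
    have "0 \<le> real n * W" "0 \<le> real n * X * W" "0 \<le> X * W" "0 \<le> W" using MW M0 X(2) by auto
    moreover have "3 * (real n + 1) * W * (1 + X)
        = 3 * W + 3 * (real n * W) + 3 * (X * W) + 3 * (real n * X * W)"
      by (simp add: algebra_simps)
    ultimately show ?thesis using MW unfolding W_def[symmetric] by linarith
  qed
  moreover have "M * (2 * N) = real (card I) * C * (2 * real d + 2) ^ (d + 1)"
  proof -
    have "2 * real d + 2 = 2 * N" by (simp add: N_def)
    then show ?thesis by (simp add: M_def)
  qed
  ultimately show ?thesis using low by (simp add: N_def K_def)
qed

end

section \<open>Bounded minimizers\<close>

lemma continuous_on_peval: "continuous_on S (peval n I c e :: (nat \<Rightarrow> real) \<Rightarrow> real)"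
  unfolding peval_def
  by (intro continuous_intros continuous_on_subset[OF continuous_on_product_coordinates]) auto

text \<open>In the product topology on functions, a box whose coordinates from \<open>n\<close> on
  are fixed at 0 is compact by Tychonoff's theorem; the constraints cut out a closed part.\<close>

lemma compact_bounded_polyhedron:
  "compact {z \<in> int_polyhedron m n A b. \<forall>i<n. \<bar>z i\<bar> \<le> R}"
proof -
  define B :: "nat \<Rightarrow> real set" where "B i = (if i < n then {-R..R} else {0})" for i
  have "compactin (product_topology (\<lambda>i. euclidean) UNIV) (PiE UNIV B)"
    unfolding compactin_PiE by (auto simp: B_def)
  then have "compact (PiE UNIV B)"
    by (simp add: euclidean_product_topology)
  moreover have "closed (\<Inter>i<m. {x. dot n (A i) x \<le> b i})"
    unfolding dot_def
    by (intro closed_INT ballI closed_Collect_le continuous_intros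
        continuous_on_subset[OF continuous_on_product_coordinates]) auto
  ultimately have "compact (PiE UNIV B \<inter> (\<Inter>i<m. {x. dot n (A i) x \<le> b i}))"
    by (rule compact_Int_closed)
  moreover have "{z \<in> int_polyhedron m n A b. \<forall>i<n. \<bar>z i\<bar> \<le> R}
      = PiE UNIV B \<inter> (\<Inter>i<m. {x. dot n (A i) x \<le> b i})"
    by (auto simp: int_polyhedron_def Rn_def B_def PiE_UNIV_domain Pi_def abs_le_iff split: if_splits)
  ultimately show ?thesis by simp
qed

text \<open>For \<open>1 \<le> X\<close> the right-hand side is at most linear in \<open>X\<close>,
  and one factor \<open>X\<close> cancels.\<close>

lemma quadratic_bound:
  fixes X :: real
  assumes "X\<^sup>2 \<le> W * (a + b * (1 + X))" "0 \<le> W" "0 \<le> a" "0 \<le> b" "0 \<le> X"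
  shows "X \<le> max 1 (W * (a + 2 * b))"
proof (cases "1 \<le> X")
  case True
  have "a \<le> a * X" "b \<le> b * X" using True assms by (auto simp: mult_le_cancel_left1)
  then have "a + b * (1 + X) \<le> (a + 2 * b) * X" by (simp add: algebra_simps)
  then have "W * (a + b * (1 + X)) \<le> W * ((a + 2 * b) * X)"
    using assms(2) by (rule mult_left_mono)
  then have "X * X \<le> (W * (a + 2 * b)) * X" using assms(1) by (simp add: power2_eq_square mult_ac)
  then show ?thesis using True by (simp add: mult_le_cancel_right)
qed auto

section \<open>Estimates by powers of two\<close>

lemma real_le_two_power: "k \<le> L \<Longrightarrow> real k \<le> 2 ^ L"
  by (meson less_exp of_nat_le_numeral_power_cancel_iff less_imp_le order_trans)

lemma real_Suc_le_two_power: "k \<le> L \<Longrightarrow> real (k + 1) \<le> 2 ^ L"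
proof -
  assume k: "k \<le> L"
  have "k + 1 \<le> 2 ^ k" by (metis Suc_eq_plus1 Suc_leI less_exp)
  then have "real (k + 1) \<le> 2 ^ k" by (simp only: of_nat_le_numeral_power_cancel_iff)
  also have "\<dots> \<le> 2 ^ L" using k by simp
  finally show ?thesis .
qed

lemma power_le_two_power:
  fixes x :: real
  assumes "0 \<le> x" "x \<le> 2 ^ a" "k \<le> b"
  shows "x ^ k \<le> 2 ^ (a * b)"
proof -
  have "x ^ k \<le> (2 ^ a) ^ k" using assms by (intro power_mono)
  also have "\<dots> \<le> (2 ^ a) ^ b" using assms by (intro power_increasing) auto
  finally show ?thesis by (simp add: power_mult)
qed

lemma mult_le_two_power:
  fixes x y :: real
  assumes "x \<le> 2 ^ a" "y \<le> 2 ^ b" "0 \<le> y"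
  shows "x * y \<le> 2 ^ (a + b)"
  unfolding power_add using assms by (intro mult_mono) auto

lemma two_power_le: "a \<le> b \<Longrightarrow> x \<le> 2 ^ a \<Longrightarrow> x \<le> (2::real) ^ b"
  by (meson order_trans power_increasing one_le_numeral)

lemma nat_power_chain:
  fixes L :: nat assumes "1 \<le> L"
  shows "1 \<le> L" "L \<le> L ^ 2" "L ^ 2 \<le> L ^ 3" "L ^ 3 \<le> L ^ 4"
  using assms power_increasing[of 1 2 L] power_increasing[of 2 3 L] power_increasing[of 3 4 L] by auto

text \<open>Adding the exponents of the factors gives \<open>2 * L + 8 * L^2 + 12 * L^3\<close>,
  hence the constant 22.\<close>

lemma lin_bound_le:
  assumes n: "n \<le> L" and L: "1 \<le> L"
  shows "lin_bound n (2 ^ (6 * L\<^sup>2)) \<le> 2 ^ (22 * L ^ 3)"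
proof -
  let ?E = "2 ^ (6 * L\<^sup>2) :: real"
  note n2 = real_le_two_power[OF n]
  have "fact n \<le> real n ^ n" using fact_le_power[of n, where 'a = real] by simp
  also have "\<dots> \<le> 2 ^ (L * L)" using n2 n by (intro power_le_two_power) auto
  finally have 1: "fact n \<le> (2::real) ^ (L * L)" .
  have "?E\<^sup>2 \<le> 2 ^ (6 * L\<^sup>2 * 2)" by (rule power_le_two_power) auto
  then have "real n * ?E\<^sup>2 \<le> 2 ^ (L + 6 * L\<^sup>2 * 2)" using n2 by (intro mult_le_two_power) auto
  then have 2: "(real n * ?E\<^sup>2) ^ n \<le> 2 ^ ((L + 6 * L\<^sup>2 * 2) * L)"
    using n by (intro power_le_two_power) auto
  have 3: "(real n)\<^sup>2 \<le> 2 ^ (L * 2)" using n2 by (intro power_le_two_power) auto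
  have "lin_bound n ?E \<le> 2 ^ (L * 2 + 6 * L\<^sup>2 + (L * L + (L + 6 * L\<^sup>2 * 2) * L))"
    unfolding lin_bound_def by (intro mult_le_two_power 1 2 3) auto
  moreover have "L * 2 + 6 * L\<^sup>2 + (L * L + (L + 6 * L\<^sup>2 * 2) * L) \<le> 22 * L ^ 3"
  proof -
    have "L * 2 + 6 * L\<^sup>2 + (L * L + (L + 6 * L\<^sup>2 * 2) * L) = 2 * L + 8 * L\<^sup>2 + 12 * L ^ 3"
      by (simp add: algebra_simps power2_eq_square power3_eq_cube)
    then show ?thesis using nat_power_chain[OF L] by linarith
  qed
  ultimately show ?thesis by (rule two_power_le[rotated])
qed

section \<open>The size of a minimizer for integral data\<close>

context convex_int_poly
begin

lemma minimizer_bound: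
  assumes L: "1 \<le> L" and nL: "n \<le> L" and dL: "d \<le> L" and IL: "card I \<le> L" and C: "C = 2 ^ L"
    and A: "\<And>i j. i < m \<Longrightarrow> j < n \<Longrightarrow> \<bar>A i j\<bar> \<le> 2 ^ L" and b: "\<And>i. i < m \<Longrightarrow> \<bar>b i\<bar> \<le> 2 ^ L"
    and ne: "int_polyhedron m n A b \<noteq> {}"
    and lower: "\<And>y. y \<in> int_polyhedron m n A b \<Longrightarrow> M \<le> F y"
  shows "\<exists>z\<in>int_polyhedron m n A b. (\<forall>y\<in>int_polyhedron m n A b. F z \<le> F y) \<and>
    (\<forall>i<n. \<bar>z i\<bar> \<le> 2 ^ (93 * L ^ 4))"
proof -
  let ?P = "int_polyhedron m n A b"
  \<comment> \<open>The exponent sums up the last product bounded below: \<open>44 * L^3\<close>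
    from \<open>K^2\<close>, \<open>6 * L^2\<close> from \<open>e\<close>, \<open>17 * L^2\<close>
    from \<open>\<kappa>\<close> and \<open>26 * L^4\<close> from the last factor.\<close>
  define R :: real where "R = 2 ^ (93 * L ^ 4)"
  define K :: real where "K = 2 ^ (22 * L ^ 3)"
  \<comment> \<open>\<open>abs_G_le\<close> gives the exponent \<open>2 * L^2 + 4 * L\<close> for
    \<open>G\<close>; the same \<open>E\<close> dominates the entries of \<open>A\<close>.\<close>
  define E :: int where "E = 2 ^ (6 * L\<^sup>2)"
  note chain = nat_power_chain[OF L]
  note bounds = real_le_two_power[OF nL] real_Suc_le_two_power[OF nL] real_le_two_power[OF dL]
    real_Suc_le_two_power[OF dL] real_le_two_power[OF IL]
  have E1: "1 \<le> E" by (simp add: E_def)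
  have rE: "real_of_int E = 2 ^ (6 * L\<^sup>2)" by (simp add: E_def)
  have C0: "0 \<le> C" by (simp add: C)
  have GE: "\<bar>G i j\<bar> \<le> E" if "i < n" "j < n" for i j
  proof -
    have "\<bar>real_of_int (G i j)\<bar>
        \<le> real (d + 1) ^ n * (real (card I) * (C * (real d)\<^sup>2 * real (d + 1) ^ d))"
      by (rule abs_G_le[OF that C0])
    also have "\<dots> \<le> 2 ^ (L * L + (L + (L + L * 2 + L * L)))"
      using C0 nL dL unfolding C by (intro mult_le_two_power power_le_two_power bounds) auto
    also have "\<dots> \<le> 2 ^ (6 * L\<^sup>2)"
      using chain by (intro power_increasing) (auto simp: power2_eq_square)
    finally have "real_of_int \<bar>G i j\<bar> \<le> real_of_int E" by (simp add: rE)
    then show ?thesis by (simp only: of_int_le_iff)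
  qed
  have AE: "\<bar>A i j\<bar> \<le> E" if "i < m" "j < n" for i j
  proof -
    have "(2::int) ^ L \<le> E" unfolding E_def using chain by (intro power_increasing) auto
    then show ?thesis using A[OF that] by linarith
  qed
  have KE: "lin_bound n (of_int E) \<le> K" unfolding rE K_def by (rule lin_bound_le[OF nL L])
  have KQ: "K * 2 ^ L \<le> 2 ^ (23 * L ^ 3)"
    unfolding K_def power_add[symmetric] using chain by (intro power_increasing) auto
  have R23: "2 ^ (23 * L ^ 3) \<le> R"
    unfolding R_def using chain by (intro power_increasing) auto
  \<comment> \<open>A small feasible point, obtained from the zero objective, for which no
    functional has to be preserved.\<close>
  obtain x0 where x0: "x0 \<in> ?P" "\<forall>j<n. \<bar>x0 j\<bar> \<le> 2 ^ (23 * L ^ 3)"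
  proof -
    obtain x where x: "x \<in> ?P" using ne by blast
    obtain z and Q :: real where z: "z \<in> ?P" "(\<lambda>x. 0::real) z \<le> (\<lambda>x. 0) x"
      "\<forall>j<n. \<bar>z j\<bar> \<le> lin_bound n (of_int E) * Q" "Q = 2 ^ L \<or> (\<exists>a\<in>{}. Q = \<bar>dot n a z\<bar>)"
    proof (rule basic_point[OF x, of "{}" "\<lambda>_. 0" 0 E "2 ^ L"])
      show "\<And>i j. i < m \<Longrightarrow> j < n \<Longrightarrow> \<bar>A i j\<bar> \<le> E" by (rule AE)
      show "\<And>i. i < m \<Longrightarrow> \<bar>b i\<bar> \<le> 2 ^ L" by (rule b)
    qed (use E1 in auto)
    have "\<bar>z j\<bar> \<le> 2 ^ (23 * L ^ 3)" if "j < n" for j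
    proof -
      have "\<bar>z j\<bar> \<le> lin_bound n (of_int E) * 2 ^ L" using z(3,4) that by auto
      also have "\<dots> \<le> K * 2 ^ L" using KE by (intro mult_right_mono) auto
      finally show ?thesis using KQ by simp
    qed
    then show ?thesis using that z(1) by blast
  qed
  have Fx0: "F x0 \<le> 2 ^ (25 * L ^ 4)"
  proof -
    have "\<bar>F x0\<bar> \<le> real (card I) * (C * (2 ^ (23 * L ^ 3)) ^ d)"
      by (rule abs_F_le) (use x0(2) in auto)
    also have "\<dots> \<le> 2 ^ (L + (L + (23 * L ^ 3) * L))"
    proof -
      have "((2::real) ^ (23 * L ^ 3)) ^ d \<le> 2 ^ ((23 * L ^ 3) * L)"
        by (rule power_le_two_power) (use dL in auto)
      then show ?thesis unfolding C by (intro mult_le_two_power bounds) auto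
    qed
    also have "\<dots> \<le> 2 ^ (25 * L ^ 4)"
    proof (rule power_increasing)
      have "(23 * L ^ 3) * L = 23 * L ^ 4" by (simp add: power_numeral_reduce mult_ac)
      then show "L + (L + (23 * L ^ 3) * L) \<le> 25 * L ^ 4" using chain by linarith
    qed simp
    finally show ?thesis by simp
  qed
  have small: "\<exists>z\<in>?P. F z \<le> F x \<and> (\<forall>j<n. \<bar>z j\<bar> \<le> R)" if x: "x \<in> ?P" and xx0: "F x \<le> F x0" for x
  proof -
    obtain z Q where z: "z \<in> ?P" "F z \<le> F x" "\<forall>j<n. \<bar>z j\<bar> \<le> lin_bound n (of_int E) * Q"
      and Q: "Q = 2 ^ L \<or> (\<exists>a\<in>G ` {..<n}. Q = \<bar>dot n a z\<bar>)"
    proof (rule basic_point[OF x, of "G ` {..<n}" F M E "2 ^ L"])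
      fix y u assume "y \<in> Rn n" "u \<in> Rn n" "\<And>a. a \<in> G ` {..<n} \<Longrightarrow> dot n a u = 0"
      then show "\<exists>s. \<forall>t. F (\<lambda>i. y i + t * u i) = F y + s * t" by (intro F_affine) auto
    next
      show "\<And>y. y \<in> ?P \<Longrightarrow> M \<le> F y" by (rule lower)
      show "\<And>i j. i < m \<Longrightarrow> j < n \<Longrightarrow> \<bar>A i j\<bar> \<le> E" by (rule AE)
      show "\<And>i. i < m \<Longrightarrow> \<bar>b i\<bar> \<le> 2 ^ L" by (rule b)
    qed (use E1 GE in auto)
    \<comment> \<open>\<open>X\<close> bounds the coordinates of \<open>z\<close> but is known only
      through \<open>Q\<close>. If \<open>Q\<close> comes from a row of \<open>G\<close>, growth of
      \<open>F\<close> bounds \<open>X^2\<close> by an affine function of \<open>X\<close>.\<close>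
    define X where "X = K * Q"
    have Q0: "0 \<le> Q" using Q by auto
    have X0: "0 \<le> X" using Q0 by (simp add: X_def K_def)
    have zX: "\<bar>z j\<bar> \<le> X" if "j < n" for j
      using z(3) that mult_right_mono[OF KE Q0] unfolding X_def by fastforce
    have zR: "z \<in> Rn n" using z(1) by (simp add: int_polyhedron_def)
    have "X \<le> R"
      using Q
    proof
      assume "Q = 2 ^ L"
      then show ?thesis using KQ R23 by (simp add: X_def)
    next
      assume "\<exists>a\<in>G ` {..<n}. Q = \<bar>dot n a z\<bar>"
      then obtain i where i: "i < n" "Q = \<bar>dot n (G i) z\<bar>" by auto
      define e where "e = real_of_int E"
      define \<kappa> where "\<kappa> = 4 * real (d + 1) ^ (n + 2) * (2 * real d + 5) ^ (d + 2)"
      define K2 where "K2 = 3 * (real n + 1) * (real (card I) * C * (2 * real d + 2) ^ (d + 1))"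
      have e1: "1 \<le> e" using E1 by (simp add: e_def)
      have \<kappa>0: "0 < \<kappa>" by (simp add: \<kappa>_def)
      have K0: "0 < K" by (simp add: K_def)
      have K20: "0 \<le> K2" using C0 by (simp add: K2_def)
      have "real_of_int (G i i) \<le> e" using GE[OF i(1) i(1)] by (simp add: e_def)
      then have "(dot n (G i) z)\<^sup>2 \<le> e * q z" using e1 by (intro dot_G_square_le[OF zR i(1)]) auto
      then have "Q\<^sup>2 \<le> e * q z" using i(2) by simp
      also have "\<dots> \<le> e * (\<kappa> * (2 ^ (25 * L ^ 4) + K2 * (1 + X)))"
      proof (rule mult_left_mono)
        have "q z / \<kappa> - K2 * (1 + X) \<le> F z"
          unfolding \<kappa>_def K2_def by (rule F_growth[OF zR zX X0 C0])
        also have "\<dots> \<le> 2 ^ (25 * L ^ 4)" using z(2) xx0 Fx0 by simp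
        finally show "q z \<le> \<kappa> * (2 ^ (25 * L ^ 4) + K2 * (1 + X))"
          using \<kappa>0 by (simp add: field_simps)
      qed (use e1 in simp)
      finally have "K\<^sup>2 * Q\<^sup>2 \<le> K\<^sup>2 * (e * (\<kappa> * (2 ^ (25 * L ^ 4) + K2 * (1 + X))))"
        by (intro mult_left_mono) auto
      then have "X\<^sup>2 \<le> (K\<^sup>2 * e * \<kappa>) * (2 ^ (25 * L ^ 4) + K2 * (1 + X))"
        by (simp add: X_def power_mult_distrib mult_ac)
      then have Xle: "X \<le> max 1 ((K\<^sup>2 * e * \<kappa>) * (2 ^ (25 * L ^ 4) + 2 * K2))"
        using e1 \<kappa>0 K20 X0 by (intro quadratic_bound) auto
      have k1: "\<kappa> \<le> 2 ^ (17 * L\<^sup>2)"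
      proof -
        have "2 * real d + 5 \<le> 8 * real (d + 1)" by simp
        also have "\<dots> \<le> 2 ^ (3 + L)" using bounds(4) by (simp add: power_add)
        finally have "2 * real d + 5 \<le> 2 ^ (3 + L)" .
        then have "\<kappa> \<le> 2 ^ (2 + L * (L + 2) + (3 + L) * (L + 2))"
          unfolding \<kappa>_def using nL dL by (intro mult_le_two_power power_le_two_power bounds) auto
        moreover have "2 + L * (L + 2) + (3 + L) * (L + 2) \<le> 17 * L\<^sup>2"
        proof -
          have "2 + L * (L + 2) + (3 + L) * (L + 2) = 2 * L\<^sup>2 + 7 * L + 8"
            by (simp add: algebra_simps power2_eq_square)
          then show ?thesis using chain by linarith
        qed
        ultimately show ?thesis by (rule two_power_le[rotated])
      qed
      have k2: "K2 \<le> 2 ^ (9 * L\<^sup>2)"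
      proof -
        have "2 * real d + 2 \<le> 2 ^ (L + 1)" using bounds(4) by simp
        then have "K2 \<le> 2 ^ (2 + L + (L + L + (L + 1) * (L + 1)))"
          unfolding K2_def C using dL bounds(2)
          by (intro mult_le_two_power power_le_two_power bounds) auto
        moreover have "2 + L + (L + L + (L + 1) * (L + 1)) \<le> 9 * L\<^sup>2"
        proof -
          have "2 + L + (L + L + (L + 1) * (L + 1)) = L\<^sup>2 + 5 * L + 3"
            by (simp add: algebra_simps power2_eq_square)
          then show ?thesis using chain by linarith
        qed
        ultimately show ?thesis by (rule two_power_le[rotated])
      qed
      have k3: "2 ^ (25 * L ^ 4) + 2 * K2 \<le> 2 ^ (26 * L ^ 4)"
      proof -
        have "2 * K2 \<le> 2 ^ (1 + 9 * L\<^sup>2)" using k2 by simp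
        also have "\<dots> \<le> 2 ^ (25 * L ^ 4)" using chain by (intro power_increasing) auto
        finally have "2 ^ (25 * L ^ 4) + 2 * K2 \<le> 2 ^ (1 + 25 * L ^ 4)" by simp
        also have "\<dots> \<le> 2 ^ (26 * L ^ 4)" using chain by (intro power_increasing) auto
        finally show ?thesis .
      qed
      have "K\<^sup>2 \<le> 2 ^ (22 * L ^ 3 * 2)" unfolding K_def by (rule power_le_two_power) auto
      then have "(K\<^sup>2 * e * \<kappa>) * (2 ^ (25 * L ^ 4) + 2 * K2)
          \<le> 2 ^ (22 * L ^ 3 * 2 + 6 * L\<^sup>2 + 17 * L\<^sup>2 + 26 * L ^ 4)"
        using \<kappa>0 K20 e1 by (intro mult_le_two_power k1 k3) (auto simp: e_def rE)
      also have "\<dots> \<le> R" unfolding R_def using chain by (intro power_increasing) auto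
      finally have "(K\<^sup>2 * e * \<kappa>) * (2 ^ (25 * L ^ 4) + 2 * K2) \<le> R" .
      moreover have "1 \<le> R" by (simp add: R_def)
      ultimately show ?thesis using Xle by simp
    qed
    then show ?thesis using z(1,2) zX by (intro bexI[of _ z]) (auto intro: order_trans)
  qed
  \<comment> \<open>Minimize over this compact part: points of \<open>?P\<close> above the level of
    \<open>x0\<close> lose to \<open>x0\<close>, the others to their bounded replacements from
    \<open>small\<close>.\<close>
  define S where "S = {z \<in> ?P. \<forall>i<n. \<bar>z i\<bar> \<le> R}"
  have x0S: "x0 \<in> S" using x0 R23 by (auto simp: S_def intro: order_trans)
  have "compact S" unfolding S_def by (rule compact_bounded_polyhedron)
  moreover have "continuous_on S F" unfolding F_def by (rule continuous_on_peval)
  ultimately obtain xs where xs: "xs \<in> S" "\<And>y. y \<in> S \<Longrightarrow> F xs \<le> F y"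
    using continuous_attains_inf[of S F] x0S by blast
  have "F xs \<le> F y" if y: "y \<in> ?P" for y
  proof (cases "F y \<le> F x0")
    case True
    then obtain z where "z \<in> ?P" "F z \<le> F y" "\<forall>j<n. \<bar>z j\<bar> \<le> R" using small[OF y] by blast
    then show ?thesis using xs(2)[of z] by (simp add: S_def)
  next
    case False
    then show ?thesis using xs(2)[OF x0S] by simp
  qed
  then show ?thesis using xs(1) by (auto simp: S_def R_def)
qed

end

section \<open>Bit lengths and clearing of denominators\<close>

lemma abs_le_two_power_bl_int: "\<bar>k\<bar> \<le> 2 ^ bl_int k"
proof (cases "k = 0")
  case False
  have pos: "0 < \<bar>real_of_int k\<bar>" using False by simp
  have "log 2 \<bar>real_of_int k\<bar> \<le> real (bl_int k)"
    unfolding bl_int_def using le_of_int_ceiling[of "log 2 \<bar>real_of_int k\<bar>"] by linarith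
  then have "\<bar>real_of_int k\<bar> \<le> 2 powr real (bl_int k)"
    using pos by (simp add: log_le_iff)
  then have "real_of_int \<bar>k\<bar> \<le> real_of_int (2 ^ bl_int k)" by (simp add: powr_realpow)
  then show ?thesis by (simp only: of_int_le_iff)
qed simp

lemma bl_rat_pos: "1 \<le> bl_rat r"
  by (auto simp: bl_rat_def bl_int_def split: prod.split)

text \<open>Take the product of all denominators. Each scaled number is its numerator times the
  other denominators, so it involves one factor per entry, each at most
  \<open>2 ^ bl_rat (r s)\<close>.\<close>

lemma common_denominator:
  fixes r :: "'a \<Rightarrow> rat"
  assumes S: "finite S"
  obtains D :: int and c :: "'a \<Rightarrow> int" where "0 < D"
    "\<forall>s\<in>S. real_of_int (c s) = real_of_int D * of_rat (r s)"
    "\<forall>s\<in>S. \<bar>c s\<bar> \<le> 2 ^ (\<Sum>s\<in>S. bl_rat (r s))"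
proof -
  define num den where "num s = fst (quotient_of (r s))" and "den s = snd (quotient_of (r s))" for s
  have den: "0 < den s" for s using quotient_of_denom_pos'[of "r s"] by (simp add: den_def)
  have r: "of_rat (r s) = real_of_int (num s) / real_of_int (den s)" for s
  proof -
    have "r s = of_int (num s) / of_int (den s)"
      by (rule quotient_of_div) (simp add: num_def den_def)
    then have "of_rat (r s) = (of_rat (of_int (num s) / of_int (den s)) :: real)" by (rule arg_cong)
    then show ?thesis by (simp add: of_rat_divide)
  qed
  have bl: "bl_rat (r s) = bl_int (num s) + bl_int (den s)" for s
    by (simp add: bl_rat_def num_def den_def split: prod.split)
  have den_le: "den s \<le> 2 ^ bl_rat (r s)" for s
  proof -
    have "den s \<le> 2 ^ bl_int (den s)" using abs_le_two_power_bl_int[of "den s"] by simp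
    also have "\<dots> \<le> 2 ^ bl_rat (r s)" by (intro power_increasing) (auto simp: bl)
    finally show ?thesis .
  qed
  have num_le: "\<bar>num s\<bar> \<le> 2 ^ bl_rat (r s)" for s
  proof -
    have "\<bar>num s\<bar> \<le> 2 ^ bl_int (num s)" by (rule abs_le_two_power_bl_int)
    also have "\<dots> \<le> 2 ^ bl_rat (r s)" by (intro power_increasing) (auto simp: bl)
    finally show ?thesis .
  qed
  define c where "c s = num s * (\<Prod>t\<in>S - {s}. den t)" for s
  show ?thesis
  proof (rule that[of "\<Prod>s\<in>S. den s" c])
    show "0 < (\<Prod>s\<in>S. den s)" using den by (intro prod_pos) auto
    show "\<forall>s\<in>S. real_of_int (c s) = real_of_int (\<Prod>s\<in>S. den s) * of_rat (r s)"
    proof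
      fix s assume s: "s \<in> S"
      have "real_of_int (\<Prod>s\<in>S. den s) * of_rat (r s)
          = real_of_int (den s) * real_of_int (\<Prod>t\<in>S - {s}. den t) * of_rat (r s)"
        using prod.remove[OF S s, of den] by simp
      also have "\<dots> = real_of_int (c s)" using den[of s] by (simp add: r c_def)
      finally show "real_of_int (c s) = real_of_int (\<Prod>s\<in>S. den s) * of_rat (r s)" ..
    qed
    show "\<forall>s\<in>S. \<bar>c s\<bar> \<le> 2 ^ (\<Sum>s\<in>S. bl_rat (r s))"
    proof
      fix s assume s: "s \<in> S"
      have "\<bar>c s\<bar> = \<bar>num s\<bar> * (\<Prod>t\<in>S - {s}. den t)"
        using den by (simp add: c_def abs_mult abs_prod abs_of_pos)
      also have "\<dots> \<le> 2 ^ bl_rat (r s) * (\<Prod>t\<in>S - {s}. 2 ^ bl_rat (r t))"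
        using num_le den_le den by (intro mult_mono prod_mono) (auto intro!: prod_pos less_imp_le)
      also have "\<dots> = 2 ^ (\<Sum>s\<in>S. bl_rat (r s))"
        using sum.remove[OF S s, of "\<lambda>s. bl_rat (r s)"] by (simp add: power_add power_sum)
      finally show "\<bar>c s\<bar> \<le> 2 ^ (\<Sum>s\<in>S. bl_rat (r s))" .
    qed
  qed
qed

lemma enorm_le:
  assumes "\<And>i. i < n \<Longrightarrow> \<bar>x i\<bar> \<le> R"
  shows "enorm n x \<le> real n * R"
proof -
  have "enorm n x \<le> (\<Sum>i<n. \<bar>x i\<bar>)"
    using L2_set_le_sum_abs[of x "{..<n}"] by (simp add: enorm_def L2_set_def)
  also have "\<dots> \<le> (\<Sum>i<n. R)" using assms by (intro sum_mono) auto
  finally show ?thesis by simp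
qed

text \<open>The coefficients of \<open>94 * (u + v) ^ 4\<close>; 94 is the 93 of
  \<open>minimizer_bound\<close> plus one for passing to the Euclidean norm.\<close>

definition quartic :: "nat \<Rightarrow> nat \<Rightarrow> real" where
  "quartic i j = (if i + j = 4 then 94 * real (4 choose i) else 0)"

lemma poly2_quartic: "poly2 quartic 4 u v = 94 * (u + v) ^ 4"
proof -
  have "poly2 quartic 4 u v = (\<Sum>i\<le>4. 94 * (real (4 choose i) * u ^ i * v ^ (4 - i)))"
    unfolding poly2_def
  proof (intro sum.cong refl)
    fix i :: nat assume i: "i \<in> {..4}"
    have "(\<Sum>j\<le>4. quartic i j * u ^ i * v ^ j)
        = (\<Sum>j\<le>4. if j = 4 - i then 94 * (real (4 choose i) * u ^ i * v ^ j) else 0)"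
      using i by (intro sum.cong refl) (auto simp: quartic_def)
    then show "(\<Sum>j\<le>4. quartic i j * u ^ i * v ^ j) = 94 * (real (4 choose i) * u ^ i * v ^ (4 - i))"
      by simp
  qed
  also have "\<dots> = 94 * (u + v) ^ 4" by (simp add: binomial_ring sum_distrib_left)
  finally show ?thesis .
qed

text \<open>Objective and constraints are scaled by separate positive integers, which changes
  neither the polyhedron nor the minimizers.\<close>

lemma bounded_minimizer:
  assumes n: "1 \<le> n" and f: "is_mpoly n f" "convex_mpoly n f"
    and ne: "polyhedron m n A b \<noteq> {}"
    and lower: "\<And>y. y \<in> polyhedron m n A b \<Longrightarrow> M \<le> mpoly_eval n f y"
  defines "L \<equiv> enc_mpoly n f + enc_polyhedron m n A b"
  shows "\<exists>z\<in>polyhedron m n A b. (\<forall>y\<in>polyhedron m n A b. mpoly_eval n f z \<le> mpoly_eval n f y) \<and>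
    (\<forall>i<n. \<bar>z i\<bar> \<le> 2 ^ (93 * L ^ 4))"
proof -
  define I where "I = mpoly_support f"
  define d where "d = mpoly_degree n f"
  have fin: "finite I" using f(1) by (simp add: is_mpoly_def I_def)
  define s where "s = (\<Sum>\<alpha>\<in>I. bl_rat (f \<alpha>))"
  have enc: "enc_mpoly n f = n + d + s" by (simp add: enc_mpoly_def d_def s_def I_def)
  have sL: "s \<le> L" and nL: "n \<le> L" and dL: "d \<le> L" by (simp_all add: L_def enc)
  have L1: "1 \<le> L" using n nL by simp
  \<comment> \<open>Every nonzero coefficient takes at least one bit.\<close>
  have IL: "card I \<le> L"
  proof -
    have "card I = (\<Sum>\<alpha>\<in>I. 1)" by simp
    also have "\<dots> \<le> s" unfolding s_def by (intro sum_mono bl_rat_pos)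
    finally show ?thesis using sL by simp
  qed
  obtain D c where D: "0 < D" and c: "\<forall>\<alpha>\<in>I. real_of_int (c \<alpha>) = real_of_int D * of_rat (f \<alpha>)"
    and cs: "\<forall>\<alpha>\<in>I. \<bar>c \<alpha>\<bar> \<le> 2 ^ s"
    unfolding s_def by (rule common_denominator[OF fin, of f])
  have eval: "peval n I (\<lambda>\<alpha>. real_of_int (c \<alpha>)) (\<lambda>\<alpha>. \<alpha>) x = real_of_int D * mpoly_eval n f x" for x
    using c by (simp add: peval_def mpoly_eval_def I_def sum_distrib_left mult_ac)
  interpret convex_int_poly n d I c "2 ^ L"
  proof
    show "(\<Sum>i<n. \<alpha> i) \<le> d" if "\<alpha> \<in> I" for \<alpha>
      unfolding d_def mpoly_degree_def using that fin by (intro Max_ge) (auto simp: I_def)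
    show "\<bar>real_of_int (c \<alpha>)\<bar> \<le> 2 ^ L" if "\<alpha> \<in> I" for \<alpha>
    proof -
      have "\<bar>c \<alpha>\<bar> \<le> 2 ^ s" using cs that by blast
      also have "(2::int) ^ s \<le> 2 ^ L" using sL by (intro power_increasing) auto
      finally have "real_of_int \<bar>c \<alpha>\<bar> \<le> real_of_int (2 ^ L)" by (simp only: of_int_le_iff)
      then show ?thesis by simp
    qed
    fix x y :: "nat \<Rightarrow> real" and t :: real
    assume "x \<in> Rn n" "y \<in> Rn n" "0 \<le> t" "t \<le> 1"
    then have "mpoly_eval n f (\<lambda>i. t * x i + (1 - t) * y i)
        \<le> t * mpoly_eval n f x + (1 - t) * mpoly_eval n f y"
      using f(2) by (simp add: convex_mpoly_def)
    then have "real_of_int D * mpoly_eval n f (\<lambda>i. t * x i + (1 - t) * y i)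
        \<le> real_of_int D * (t * mpoly_eval n f x + (1 - t) * mpoly_eval n f y)"
      using D by (intro mult_left_mono) auto
    then show "peval n I (\<lambda>\<alpha>. real_of_int (c \<alpha>)) (\<lambda>\<alpha>. \<alpha>) (\<lambda>i. t * x i + (1 - t) * y i)
      \<le> t * peval n I (\<lambda>\<alpha>. real_of_int (c \<alpha>)) (\<lambda>\<alpha>. \<alpha>) x
        + (1 - t) * peval n I (\<lambda>\<alpha>. real_of_int (c \<alpha>)) (\<lambda>\<alpha>. \<alpha>) y"
      unfolding eval by (simp add: algebra_simps)
  qed
  have F: "F x = real_of_int D * mpoly_eval n f x" for x by (simp add: F_def eval)
  \<comment> \<open>\<open>b\<close> becomes column \<open>n\<close> of \<open>A\<close>, so that
    one common denominator serves both.\<close>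
  define r where "r = (\<lambda>(i, j). if j < n then A i j else b i)"
  obtain D' a where D': "0 < D'"
    and a: "\<forall>p\<in>{..<m} \<times> {..<Suc n}. real_of_int (a p) = real_of_int D' * of_rat (r p)"
    and abnd: "\<forall>p\<in>{..<m} \<times> {..<Suc n}. \<bar>a p\<bar> \<le> 2 ^ (\<Sum>p\<in>{..<m} \<times> {..<Suc n}. bl_rat (r p))"
    by (rule common_denominator[of "{..<m} \<times> {..<Suc n}" r]) auto
  have "(\<Sum>p\<in>{..<m} \<times> {..<Suc n}. bl_rat (r p)) = (\<Sum>i<m. \<Sum>j<Suc n. bl_rat (r (i, j)))"
    unfolding sum.cartesian_product by (intro sum.cong) auto
  also have "\<dots> = (\<Sum>i<m. (\<Sum>j<n. bl_rat (A i j)) + bl_rat (b i))"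
    by (simp add: r_def)
  also have "\<dots> \<le> L" by (simp add: sum.distrib L_def enc_polyhedron_def)
  finally have rL: "(\<Sum>p\<in>{..<m} \<times> {..<Suc n}. bl_rat (r p)) \<le> L" .
  have aL: "\<bar>a p\<bar> \<le> 2 ^ L" if "p \<in> {..<m} \<times> {..<Suc n}" for p
  proof -
    have "\<bar>a p\<bar> \<le> 2 ^ (\<Sum>p\<in>{..<m} \<times> {..<Suc n}. bl_rat (r p))" using abnd that by blast
    also have "\<dots> \<le> 2 ^ L" using rL by (intro power_increasing) auto
    finally show ?thesis .
  qed
  define A' where "A' i j = a (i, j)" for i j
  define b' where "b' i = real_of_int (a (i, n))" for i
  have P: "int_polyhedron m n A' b' = polyhedron m n A b"
  proof -
    have "dot n (A' i) x \<le> b' i \<longleftrightarrow> (\<Sum>j<n. of_rat (A i j) * x j) \<le> of_rat (b i)" if "i < m" for i x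
    proof -
      have "dot n (A' i) x = real_of_int D' * (\<Sum>j<n. of_rat (A i j) * x j)"
        using a that by (simp add: dot_def A'_def r_def sum_distrib_left mult_ac)
      moreover have "b' i = real_of_int D' * of_rat (b i)" using a that by (simp add: b'_def r_def)
      ultimately show ?thesis using D' by simp
    qed
    then show ?thesis by (auto simp: int_polyhedron_def polyhedron_def)
  qed
  have "\<exists>z\<in>int_polyhedron m n A' b'. (\<forall>y\<in>int_polyhedron m n A' b'. F z \<le> F y) \<and>
      (\<forall>i<n. \<bar>z i\<bar> \<le> 2 ^ (93 * L ^ 4))"
  proof (rule minimizer_bound[OF L1 nL dL IL refl, where M = "real_of_int D * M"])
    show "\<bar>A' i j\<bar> \<le> 2 ^ L" if "i < m" "j < n" for i j using aL[of "(i, j)"] that by (simp add: A'_def)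
    show "\<bar>b' i\<bar> \<le> 2 ^ L" if "i < m" for i
    proof -
      have "\<bar>a (i, n)\<bar> \<le> 2 ^ L" using aL that by simp
      then have "real_of_int \<bar>a (i, n)\<bar> \<le> real_of_int (2 ^ L)" by (simp only: of_int_le_iff)
      then show ?thesis by (simp add: b'_def)
    qed
    show "int_polyhedron m n A' b' \<noteq> {}" using ne by (simp add: P)
    show "real_of_int D * M \<le> F y" if "y \<in> int_polyhedron m n A' b'" for y
      unfolding F using lower that D by (intro mult_left_mono) (auto simp: P)
  qed
  then show ?thesis using D by (simp add: P F)
qed

text \<open>For \<open>xs = 0\<close> the left-hand side is informally minus infinity, hence the
  guard before \<open>log\<close>.\<close>

theorem theorem1p1:
  shows "\<exists>(c :: nat \<Rightarrow> nat \<Rightarrow> real) (D :: nat).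
    \<forall>(n :: nat) (f :: (nat \<Rightarrow> nat) \<Rightarrow> rat) (m :: nat)
      (A :: nat \<Rightarrow> nat \<Rightarrow> rat) (b :: nat \<Rightarrow> rat).
      1 \<le> n \<longrightarrow> is_mpoly n f \<longrightarrow> convex_mpoly n f \<longrightarrow>
      polyhedron m n A b \<noteq> {} \<longrightarrow>
      (\<forall>M::real. \<exists>y\<in>polyhedron m n A b. mpoly_eval n f y < M)
      \<or> (\<exists>xs\<in>polyhedron m n A b.
           (\<forall>y\<in>polyhedron m n A b. mpoly_eval n f xs \<le> mpoly_eval n f y) \<and>
           (enorm n xs \<noteq> 0 \<longrightarrow>
              log 2 (enorm n xs) \<le> poly2 c D (real (enc_mpoly n f)) (real (enc_polyhedron m n A b))))"
proof (rule exI[of _ quartic], rule exI[of _ 4], intro allI impI)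
  fix n :: nat and f :: "(nat \<Rightarrow> nat) \<Rightarrow> rat" and m :: nat
    and A :: "nat \<Rightarrow> nat \<Rightarrow> rat" and b :: "nat \<Rightarrow> rat"
  let ?P = "polyhedron m n A b"
  let ?L = "enc_mpoly n f + enc_polyhedron m n A b"
  assume asm: "1 \<le> n" "is_mpoly n f" "convex_mpoly n f" "?P \<noteq> {}"
  show "(\<forall>M::real. \<exists>y\<in>?P. mpoly_eval n f y < M)
      \<or> (\<exists>xs\<in>?P. (\<forall>y\<in>?P. mpoly_eval n f xs \<le> mpoly_eval n f y) \<and>
           (enorm n xs \<noteq> 0 \<longrightarrow>
              log 2 (enorm n xs) \<le> poly2 quartic 4 (real (enc_mpoly n f)) (real (enc_polyhedron m n A b))))"
  proof (rule disjCI)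
    assume no_min: "\<not> (\<exists>xs\<in>?P. (\<forall>y\<in>?P. mpoly_eval n f xs \<le> mpoly_eval n f y) \<and>
           (enorm n xs \<noteq> 0 \<longrightarrow>
              log 2 (enorm n xs) \<le> poly2 quartic 4 (real (enc_mpoly n f)) (real (enc_polyhedron m n A b))))"
    show "\<forall>M::real. \<exists>y\<in>?P. mpoly_eval n f y < M"
    proof (rule ccontr)
      assume "\<not> (\<forall>M::real. \<exists>y\<in>?P. mpoly_eval n f y < M)"
      then obtain M where "\<And>y. y \<in> ?P \<Longrightarrow> M \<le> mpoly_eval n f y" by (auto simp: not_less)
      from bounded_minimizer[OF asm this] obtain z where z: "z \<in> ?P"
        "\<forall>y\<in>?P. mpoly_eval n f z \<le> mpoly_eval n f y" "\<forall>i<n. \<bar>z i\<bar> \<le> 2 ^ (93 * ?L ^ 4)"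
        by blast
      have nL: "n \<le> ?L" by (simp add: enc_mpoly_def)
      \<comment> \<open>The factor \<open>n\<close> is at most \<open>2 ^ ?L\<close> and is absorbed
        by raising 93 to 94.\<close>
      have "enorm n z \<le> real n * 2 ^ (93 * ?L ^ 4)" using z(3) by (intro enorm_le) auto
      also have "\<dots> \<le> 2 ^ (?L + 93 * ?L ^ 4)"
        by (intro mult_le_two_power real_le_two_power nL) auto
      also have "\<dots> \<le> 2 ^ (94 * ?L ^ 4)"
        using nat_power_chain[of ?L] nL asm(1) by (intro power_increasing) auto
      finally have norm: "enorm n z \<le> 2 ^ (94 * ?L ^ 4)" .
      have "log 2 (enorm n z) \<le> poly2 quartic 4 (real (enc_mpoly n f)) (real (enc_polyhedron m n A b))"
        if "enorm n z \<noteq> 0"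
      proof -
        have "0 < enorm n z" using that by (simp add: enorm_def sum_nonneg less_le)
        then have "log 2 (enorm n z) \<le> log 2 (2 ^ (94 * ?L ^ 4))"
          using norm by (intro log_mono) auto
        also have "\<dots> = 94 * real ?L ^ 4" by (simp add: log_nat_power)
        finally show ?thesis by (simp add: poly2_quartic)
      qed
      then show False using no_min z(1,2) by blast
    qed
  qed
qed

end
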